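(* Let $A\in\mathbb{Z}^{n\times m}$ be of rank $n$, with lattice Gale dual $D\in\mathbb{Z}^{m\times(m-n)}$. Then the Ehrhart polynomial of the associated lattice Gale zonotope $\mathcal{Z}(D^{\top})\subset\mathbb{R}^{m-n}$ is $$\mathrm{ehr}_{\mathcal{Z}(D^{\top})}(t)=\sum_{S}\frac{g(A_S)}{g(A)}\,t^{\,m-|S|},$$ where the sum is over all spanning sets $S\subseteq[m]$ in the matroid represented by $A$.
   Context: A lattice Gale dual of $A$ is a matrix $D\in\mathbb{Z}^{m\times(m-n)}$ whose columns form a lattice basis of $\ker(A)\cap\mathbb{Z}^m$. For an integer matrix $B$ with $m$ columns, $\mathcal{Z}(B)=B[0,1]^m$; $\mathcal{Z}(D^{\top})$ is the lattice Gale zonotope. The Ehrhart polynomial of a lattice polytope $\mathcal{P}\subset\mathbb{R}^d$ is the polynomial with $\mathrm{ehr}_{\mathcal P}(t)=|t\mathcal{P}\cap\mathbb{Z}^d|$ for positive integers $t$. The matroid represented by $A$ has ground set $[m]=\{1,\dots,m\}$ indexing the columns of $A$, with independence being linear independence of columns; a spanning set is a subset $S\subseteq[m]$ containing a basis, i.e., such that the columns indexed by $S$ span $\mathbb{R}^n$. $A_S$ is the submatrix of $A$ formed by the columns indexed by $S$. For an integer matrix $F$, $g(F)$ is the greatest common divisor of all maximal minors of $F$; thus $g(A_S)$ and $g(A)$ are the gcds of the $n\times n$ minors of $A_S$ and $A$. *)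

theory Defs
  imports
    "HOL-Computational_Algebra.Polynomial"
    "Jordan_Normal_Form.DL_Rank"
    "Jordan_Normal_Form.DL_Submatrix"
    "Jordan_Normal_Form.Matrix_Kernel"
    "Jordan_Normal_Form.Determinant"
begin

text \<open>
  Matrices and vectors are those of Jordan\_Normal\_Form, so that the dimensions \<open>n\<close>, \<open>m\<close> and
  \<open>m - n\<close> are ordinary natural numbers (possibly \<open>0\<close>). Indices start at \<open>0\<close>: the ground set
  \<open>[m]\<close> is \<open>{..<m}\<close>.
\<close>

abbreviation real_mat :: "int mat \<Rightarrow> real mat" where
  "real_mat \<equiv> map_mat real_of_int"

definition lattice_basis_cols :: "int mat \<Rightarrow> int vec set \<Rightarrow> bool" where
  "lattice_basis_cols B L \<longleftrightarrow>
     {B *\<^sub>v c | c. c \<in> carrier_vec (dim_col B)} = L \<and>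
     (\<forall>c \<in> carrier_vec (dim_col B). B *\<^sub>v c = 0\<^sub>v (dim_row B) \<longrightarrow> c = 0\<^sub>v (dim_col B))"

text \<open>For an integer matrix \<open>A\<close>, \<^term>\<open>mat_kernel A\<close> consists of integer vectors only, i.e.\ it is
  \<open>ker A \<inter> \<int>\<^sup>m\<close>.\<close>

definition lattice_gale_dual :: "nat \<Rightarrow> nat \<Rightarrow> int mat \<Rightarrow> int mat \<Rightarrow> bool" where
  "lattice_gale_dual n m A D \<longleftrightarrow>
     D \<in> carrier_mat m (m - n) \<and> lattice_basis_cols D (mat_kernel A)"

definition zonotope :: "int mat \<Rightarrow> real vec set" where
  "zonotope B =
     {real_mat B *\<^sub>v x | x. x \<in> carrier_vec (dim_col B) \<and> (\<forall>i < dim_col B. 0 \<le> x $ i \<and> x $ i \<le> 1)}"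

definition int_points :: "nat \<Rightarrow> real vec set" where
  "int_points d = {v \<in> carrier_vec d. \<forall>i < d. v $ i \<in> \<int>}"

definition dilate :: "nat \<Rightarrow> real vec set \<Rightarrow> real vec set" where
  "dilate t P = (\<lambda>v. real t \<cdot>\<^sub>v v) ` P"

text \<open>Finiteness is required explicitly because \<^const>\<open>card\<close> is \<open>0\<close> on infinite sets.\<close>

definition is_ehrhart_polynomial :: "nat \<Rightarrow> real vec set \<Rightarrow> real poly \<Rightarrow> bool" where
  "is_ehrhart_polynomial d P p \<longleftrightarrow>
     (\<forall>t::nat. t > 0 \<longrightarrow>
        finite (dilate t P \<inter> int_points d) \<and>
        poly p (real t) = real (card (dilate t P \<inter> int_points d)))"

lemma is_ehrhart_polynomial_unique:
  assumes "is_ehrhart_polynomial d P p" "is_ehrhart_polynomial d P q"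
  shows "p = q"
proof (rule ccontr)
  assume "p \<noteq> q"
  then have fin: "finite {x. poly (p - q) x = 0}"
    by (intro poly_roots_finite) simp
  have "real ` {0<..} \<subseteq> {x. poly (p - q) x = 0}"
    using assms by (auto simp: is_ehrhart_polynomial_def)
  then have "finite (real ` {0::nat<..})"
    using fin finite_subset by blast
  then have "finite {0::nat<..}"
    by (rule finite_imageD) (simp add: inj_on_def)
  then show False
    using infinite_Ioi by blast
qed

text \<open>Columns are indexed by elements of the ground set and may repeat; injectivity of
  \<^term>\<open>col A\<close> on \<open>I\<close> makes two equal columns dependent, since \<open>lin_dep\<close> only sees their set.\<close>

definition matroid_indep :: "int mat \<Rightarrow> nat set \<Rightarrow> bool" where
  "matroid_indep A I \<longleftrightarrow>
     I \<subseteq> {..<dim_col A} \<and> inj_on (col (real_mat A)) I \<and>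
     \<not> module.lin_dep class_ring (module_vec TYPE(real) (dim_row A)) (col (real_mat A) ` I)"

definition matroid_basis :: "int mat \<Rightarrow> nat set \<Rightarrow> bool" where
  "matroid_basis A B \<longleftrightarrow> matroid_indep A B \<and> (\<forall>I. matroid_indep A I \<and> B \<subseteq> I \<longrightarrow> I = B)"

definition matroid_spanning :: "int mat \<Rightarrow> nat set \<Rightarrow> bool" where
  "matroid_spanning A S \<longleftrightarrow> S \<subseteq> {..<dim_col A} \<and> (\<exists>B. matroid_basis A B \<and> B \<subseteq> S)"

lemma matroid_spanning_iff_span:
  assumes A: "A \<in> carrier_mat n m" and rk: "vec_space.rank n (real_mat A) = n"
  shows "matroid_spanning A S \<longleftrightarrow>
    S \<subseteq> {..<m} \<and>
    LinearCombinations.module.span class_ring (module_vec TYPE(real) n) (col (real_mat A) ` S)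
      = carrier_vec n"
proof -
  interpret V: vec_space "TYPE(real)" n .
  let ?c = "col (real_mat A)"
  have dims: "dim_row A = n" "dim_col A = m" using A by auto
  have RA: "real_mat A \<in> carrier_mat n m" using A by simp
  have cc: "?c ` T \<subseteq> carrier_vec n" if "T \<subseteq> {..<m}" for T
    using that RA by auto
  have colsA: "set (cols (real_mat A)) = ?c ` {..<m}"
    using RA by (auto simp: cols_def)
  have ind: "matroid_indep A I \<longleftrightarrow> I \<subseteq> {..<m} \<and> inj_on ?c I \<and> V.lin_indpt (?c ` I)" for I
    by (simp add: matroid_indep_def dims)
  have cols_sub: "?c ` {..<m} \<subseteq> carrier_vec n" by (rule cc) simp
  have ext: "matroid_indep A (insert j I)"
    if I: "matroid_indep A I" and j: "j < m" "?c j \<notin> V.span (?c ` I)" for I j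
  proof -
    have Ic: "?c ` I \<subseteq> carrier_vec n" using I ind cc by blast
    have li: "V.lin_indpt (?c ` I)" and inj: "inj_on ?c I" and Im: "I \<subseteq> {..<m}"
      using I ind by auto
    have nin: "?c j \<notin> ?c ` I" using j(2) V.in_own_span[of "?c ` I"] Ic by auto
    have "V.lin_indpt (insert (?c j) (?c ` I))"
      using V.lin_dep_iff_in_span[of "?c ` I" "?c j"] Ic li nin j cols_sub by auto
    moreover have "inj_on ?c (insert j I)" using inj nin by auto
    ultimately show ?thesis using ind Im j by auto
  qed
  have card_le: "card I \<le> n" if "matroid_indep A I" for I
  proof -
    have "V.lin_indpt (?c ` I)" "inj_on ?c I" "I \<subseteq> {..<m}" using that ind by auto
    then have "card (?c ` I) \<le> V.dim" using V.li_le_dim(2)[of "?c ` I"] cc V.fin_dim by auto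
    then show ?thesis using \<open>inj_on ?c I\<close> by (simp add: card_image V.dim_is_n)
  qed
  have full: "V.span (?c ` B) = carrier_vec n" if B: "matroid_indep A B" "card B = n" for B
  proof -
    have *: "V.lin_indpt (?c ` B)" "inj_on ?c B" "B \<subseteq> {..<m}" using B ind by auto
    then have "V.basis (?c ` B)"
      using V.dim_li_is_basis[of "?c ` B"] cc[OF *(3)] V.fin_dim B(2) finite_subset[OF *(3)]
      by (auto simp: card_image V.dim_is_n)
    then show ?thesis by (simp add: V.basis_def)
  qed
  have big: "card B = n"
    if B: "matroid_indep A B" and sp: "carrier_vec n \<subseteq> V.span (?c ` B)" for B
  proof -
    have *: "V.lin_indpt (?c ` B)" "inj_on ?c B" "B \<subseteq> {..<m}" using B ind by auto
    have "V.span (?c ` B) = carrier_vec n"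
      using sp V.span_is_subset2[of "?c ` B"] cc[OF *(3)] by auto
    then have "V.basis (?c ` B)" using * cc by (simp add: V.basis_def)
    then have "V.dim = card (?c ` B)"
      using V.dim_basis finite_subset[OF *(3)] by auto
    then show ?thesis using *(2) by (simp add: card_image V.dim_is_n)
  qed
  have maxi: "carrier_vec n \<subseteq> V.span (?c ` B)"
    if B: "matroid_indep A B" and T: "T \<subseteq> {..<m}" "V.span (?c ` T) = carrier_vec n"
      and mx: "\<And>j. j \<in> T \<Longrightarrow> ?c j \<in> V.span (?c ` B)" for B T
  proof -
    have "?c ` B \<subseteq> carrier_vec n" using B ind cc by blast
    moreover have "?c ` T \<subseteq> V.span (?c ` B)" using mx by blast
    ultimately have "V.span (?c ` T) \<subseteq> V.span (?c ` B)"
      by (rule V.span_subsetI)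
    then show ?thesis using T by simp
  qed
  have whole: "V.span (?c ` {..<m}) = carrier_vec n"
  proof -
    have li0: "V.lin_indpt {}" by (simp add: V.lin_dep_def)
    have "finite T \<and> card T \<le> card (?c ` {..<m})" if "T \<subseteq> ?c ` {..<m}" for T
      using that by (meson card_mono finite_imageI finite_lessThan finite_subset)
    then obtain B where B: "maximal B (\<lambda>T. T \<subseteq> ?c ` {..<m} \<and> V.lin_indpt T)"
      using maximal_exists[of "\<lambda>T. T \<subseteq> ?c ` {..<m} \<and> V.lin_indpt T" "card (?c ` {..<m})" "{}"] li0
      by blast
    then have "card B = n" using V.rank_card_indpt[OF RA] rk colsA by simp
    moreover have Bc: "B \<subseteq> ?c ` {..<m}" "V.lin_indpt B" using B by (auto simp: maximal_def)
    ultimately have "V.basis B"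
      using V.dim_li_is_basis[of B] V.fin_dim cols_sub finite_subset[OF Bc(1)] V.dim_is_n by auto
    then have "carrier_vec n \<subseteq> V.span (?c ` {..<m})"
      using V.span_is_monotone[OF Bc(1)] by (simp add: V.basis_def)
    then show ?thesis using V.span_is_subset2 cols_sub by auto
  qed
  show ?thesis
  proof (intro iffI conjI)
    assume "matroid_spanning A S"
    then obtain B where S: "S \<subseteq> {..<m}" and B: "matroid_basis A B" "B \<subseteq> S"
      by (auto simp: matroid_spanning_def dims)
    show "S \<subseteq> {..<m}" by fact
    have iB: "matroid_indep A B" using B by (simp add: matroid_basis_def)
    have "?c j \<in> V.span (?c ` B)" if "j \<in> {..<m}" for j
    proof (rule ccontr)
      assume j: "?c j \<notin> V.span (?c ` B)"
      then have "matroid_indep A (insert j B)" using ext[OF iB] that by simp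
      then have "insert j B = B" using B(1) unfolding matroid_basis_def by blast
      then have "?c j \<in> ?c ` B" by auto
      moreover have "?c ` B \<subseteq> carrier_vec n" using iB ind cc by blast
      ultimately show False using j V.in_own_span[of "?c ` B"] by auto
    qed
    then have "carrier_vec n \<subseteq> V.span (?c ` B)" using maxi[OF iB _ whole] by auto
    moreover have "V.span (?c ` B) \<subseteq> V.span (?c ` S)"
      using B by (intro V.span_is_monotone) auto
    ultimately show "V.span (?c ` S) = carrier_vec n"
      using V.span_is_subset2[of "?c ` S"] cc[OF S] by auto
  next
    assume "S \<subseteq> {..<m} \<and> V.span (?c ` S) = carrier_vec n"
    then have S: "S \<subseteq> {..<m}" and sp: "V.span (?c ` S) = carrier_vec n" by auto
    let ?F = "{I. I \<subseteq> S \<and> matroid_indep A I}"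
    have "?F \<subseteq> Pow S" by auto
    then have "finite ?F" using S finite_subset by (metis finite_Pow_iff finite_lessThan)
    moreover have "{} \<in> ?F" by (simp add: ind V.lin_dep_def)
    ultimately obtain B where B: "B \<in> ?F" "\<And>I. I \<in> ?F \<Longrightarrow> B \<subseteq> I \<Longrightarrow> B = I"
      using finite_has_maximal[of ?F] by (metis (no_types, lifting) empty_iff)
    have iB: "matroid_indep A B" and BS: "B \<subseteq> S" using B by auto
    have "?c j \<in> V.span (?c ` B)" if "j \<in> S" for j
    proof (rule ccontr)
      assume j: "?c j \<notin> V.span (?c ` B)"
      then have "matroid_indep A (insert j B)" using ext[OF iB] that S by blast
      then have "B = insert j B" using B(2)[of "insert j B"] BS that by blast
      then have "?c j \<in> ?c ` B" by auto
      moreover have "?c ` B \<subseteq> carrier_vec n" using iB ind cc by blast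
      ultimately show False using j V.in_own_span[of "?c ` B"] by auto
    qed
    then have cB: "card B = n" using big[OF iB] maxi[OF iB S sp] by auto
    have "I = B" if "matroid_indep A I" "B \<subseteq> I" for I
    proof -
      have "finite I" using that(1) ind finite_subset[of I "{..<m}"] by auto
      then show ?thesis using card_seteq[of I B] that card_le cB by auto
    qed
    then show "matroid_spanning A S"
      using iB BS S by (auto simp: matroid_spanning_def matroid_basis_def dims)
  qed
qed

definition minors_gcd :: "int mat \<Rightarrow> int" where
  "minors_gcd F = Gcd {det (submatrix F I J) | I J.
     I \<subseteq> {..<dim_row F} \<and> J \<subseteq> {..<dim_col F} \<and>
     card I = min (dim_row F) (dim_col F) \<and> card J = min (dim_row F) (dim_col F)}"

abbreviation columns_submatrix :: "int mat \<Rightarrow> nat set \<Rightarrow> int mat" where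
  "columns_submatrix A S \<equiv> submatrix A UNIV S"

end

theory Submission
  imports Defs
begin

text \<open>
  Write \<open>y A\<close> for the combination of the rows of \<open>A\<close> with real coefficients \<open>y\<close>. The map
  \<open>D\<^sup>T : \<int>\<^sup>m \<rightarrow> \<int>\<^bsup>m - n\<^esup>\<close> is onto, because the lattice spanned by the columns of \<open>D\<close> is saturated, and
  the kernel of \<open>D\<^sup>T\<close> on \<open>\<real>\<^sup>m\<close> is the row space of \<open>A\<close>. Hence the lattice points of \<open>t Z(D\<^sup>T)\<close> are the
  integer points of \<open>[0,t]\<^sup>m + rowspace(A)\<close>, taken modulo the integer points of the row space.
  Taking them modulo the smaller lattice \<open>\<int>\<^sup>n A\<close> instead multiplies their number by the index
  of \<open>\<int>\<^sup>n A\<close> in its saturation, which turns out to be \<open>g(A)\<close>.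

  For \<open>T \<subseteq> S \<subseteq> [m]\<close> with \<open>S\<close> spanning let \<open>N(T, S)\<close> be the number of classes modulo \<open>\<int>\<^sup>n A\<^sub>S\<close> of the integer points of
  \<open>[0,t]\<^sup>T \<times> {0} + rowspace(A\<^sub>S)\<close> in \<open>\<int>\<^sup>S\<close>. These numbers obey a deletion-contraction rule for \<open>i \<in> S - T\<close>: if \<open>S - {i}\<close>
  still spans, then \<open>N(T \<union> {i}, S) = N(T, S) + t N(T, S - {i})\<close>. The reason is that, along a line
  parallel to the \<open>i\<close>-th axis, admitting the coordinate \<open>i\<close> prolongs an interval by \<open>t\<close>, and a
  prolongation of a nonempty interval by the integer \<open>t\<close> always adds exactly \<open>t\<close> integers. If \<open>S - {i}\<close>
  does not span, then the \<open>i\<close>-th axis lies in the row space and nothing changes. Unfolding the rule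
  gives
  \<open>N([m], [m]) = \<Sum>\<^bsub>S spanning\<^esub> t\<^bsup>m - |S|\<^esup> N({}, S)\<close>
  (lemma \<open>card_box_classes_eq_sum\<close>), where \<open>N({}, S)\<close> counts the integer points of
  \<open>rowspace(A\<^sub>S)\<close> modulo \<open>\<int>\<^sup>n A\<^sub>S\<close>, that is, the \<open>y \<in> [0,1)\<^sup>n\<close> with \<open>y A\<^sub>S\<close> integral.

  It remains to see that there are \<open>g(A\<^sub>S)\<close> such \<open>y\<close> (lemma
  \<open>card_torsion_points_eq_minors_gcd\<close>). Both sides depend only on the lattice generated by the columns of
  \<open>A\<^sub>S\<close>. For a triangular basis of this lattice the number of \<open>y\<close> is visibly the product of the
  diagonal entries, hence a determinant, and this determinant divides all maximal minors and is, by
  multilinearity, an integer combination of them. Dividing the resulting identity by \<open>g(A)\<close> proves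
  the formula.
\<close>

section \<open>Integer points of intervals\<close>

text \<open>
  The geometric source of the factor \<open>t\<close>. Convexity alone is enough, whichever endpoints \<open>K\<close> contains: if
  \<open>K\<close> meets \<open>\<int>\<close> exactly in \<open>{a..b}\<close>, then the prolonged set meets it in \<open>{a..b + t}\<close>; if \<open>K\<close> lies strictly
  between \<open>c\<close> and \<open>c + 1\<close>, then the prolonged set meets it in \<open>{c + 1..c + t}\<close>.
\<close>

lemma card_integers_interval_extension:
  fixes K :: "real set" and t :: nat
  assumes conv: "\<And>x y z. x \<in> K \<Longrightarrow> y \<in> K \<Longrightarrow> x \<le> z \<Longrightarrow> z \<le> y \<Longrightarrow> z \<in> K"
    and ne: "K \<noteq> {}" and fin: "finite {k::int. of_int k \<in> K}"
  shows "finite {k::int. \<exists>s\<in>K. s \<le> of_int k \<and> of_int k \<le> s + real t}"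
    and "card {k::int. \<exists>s\<in>K. s \<le> of_int k \<and> of_int k \<le> s + real t}
           = card {k::int. of_int k \<in> K} + t"
proof -
  let ?I = "{k::int. of_int k \<in> K}"
  let ?J = "{k::int. \<exists>s\<in>K. s \<le> of_int k \<and> of_int k \<le> s + real t}"
  have "finite ?J \<and> card ?J = card ?I + t"
  proof (cases "?I = {}")
    case True
    obtain s0 where s0: "s0 \<in> K" using ne by auto
    define c where "c = \<lfloor>s0\<rfloor>"
    have c0: "of_int c \<le> s0" "s0 < of_int (c + 1)" unfolding c_def by linarith+
    have noint: "of_int k \<notin> K" for k :: int using True by auto
    have c: "of_int c < s \<and> s < of_int (c + 1)" if s: "s \<in> K" for s
    proof (rule ccontr)
      assume "\<not> ?thesis"
      then consider "s \<le> of_int c" | "of_int (c + 1) \<le> s" by linarith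
      then show False
      proof cases
        case 1
        then show False using conv[OF s s0 1 c0(1)] noint by blast
      next
        case 2
        then show False using conv[OF s0 s less_imp_le[OF c0(2)] 2] noint by blast
      qed
    qed
    have "?J = {c+1..c + int t}"
    proof (intro Set.set_eqI iffI)
      fix k assume "k \<in> ?J"
      then obtain s where "s \<in> K" and s: "s \<le> of_int k" "of_int k \<le> s + real t" by auto
      have "of_int c < s" "s < of_int (c + 1)" using c[OF \<open>s \<in> K\<close>] by auto
      then have "real_of_int c < of_int k" "real_of_int k < of_int (c + 1 + int t)"
        using s by auto
      then show "k \<in> {c+1..c + int t}" unfolding of_int_less_iff by auto
    next
      fix k assume "k \<in> {c+1..c + int t}"
      then have "real_of_int (c + 1) \<le> of_int k" "real_of_int k \<le> of_int (c + int t)"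
        unfolding of_int_le_iff by auto
      then show "k \<in> ?J" using c0 s0 by (auto intro!: bexI[of _ s0])
    qed
    then show ?thesis using True by simp
  next
    case False
    define a b where "a = Min ?I" and "b = Max ?I"
    have a: "of_int a \<in> K" and b: "of_int b \<in> K"
      using Min_in[OF fin False] Max_in[OF fin False] by (auto simp: a_def b_def)
    have ab: "a \<le> k \<and> k \<le> b" if "of_int k \<in> K" for k
      using that fin by (auto simp: a_def b_def)
    have I: "?I = {a..b}"
    proof (intro Set.set_eqI iffI)
      fix k assume "k \<in> {a..b}"
      then have "of_int k \<in> K" by (intro conv[OF a b]) auto
      then show "k \<in> ?I" by simp
    qed (use ab in auto)
    have "?J = {a..b + int t}"
    proof (intro Set.set_eqI iffI)
      fix k assume "k \<in> ?J"
      then obtain s where s: "s \<in> K" "s \<le> of_int k" "of_int k \<le> s + real t" by auto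
      have "a \<le> k"
      proof (rule ccontr)
        assume "\<not> a \<le> k"
        then have "of_int k \<in> K" using conv[OF s(1) a s(2)] by simp
        then show False using ab \<open>\<not> a \<le> k\<close> by blast
      qed
      moreover have "k \<le> b + int t"
      proof (rule ccontr)
        assume *: "\<not> k \<le> b + int t"
        then have "real_of_int (b + int t) \<le> of_int k" unfolding of_int_le_iff by simp
        then have "of_int (k - int t) \<in> K" using conv[OF b s(1), of "of_int (k - int t)"] s(3) by simp
        then show False using ab * by fastforce
      qed
      ultimately show "k \<in> {a..b + int t}" by simp
    next
      fix k assume k: "k \<in> {a..b + int t}"
      show "k \<in> ?J"
      proof (cases "k \<le> b")
        case True
        then have "of_int k \<in> K" using k I by auto
        then show ?thesis by (auto intro!: bexI[of _ "of_int k"])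
      next
        case False
        then have "real_of_int b \<le> of_int k" "real_of_int k \<le> of_int (b + int t)"
          using k unfolding of_int_le_iff by auto
        then show ?thesis using b by (auto intro!: bexI[of _ "of_int b"])
      qed
    qed
    moreover have "a \<le> b" using ab a by blast
    ultimately show ?thesis using I by simp
  qed
  then show "finite ?J" "card ?J = card ?I + t" by auto
qed

text \<open>
  As \<open>s\<close> runs through \<open>[0,1)\<close>, the value \<open>d s + c\<close> runs through \<open>[c, c + d)\<close>, which contains \<open>d\<close>
  integers.
\<close>

lemma card_affine_integral_residues:
  fixes d :: int and c :: real
  assumes "d > 0"
  shows "card {s \<in> {0..<1}. of_int d * s + c \<in> \<int>} = nat d"
proof -
  let ?S = "{s \<in> {0..<1}. of_int d * s + c \<in> \<int>}"
  let ?f = "\<lambda>k::int. (of_int k - c) / of_int d"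
  have "bij_betw ?f {\<lceil>c\<rceil>..<\<lceil>c\<rceil> + d} ?S"
  proof (rule bij_betwI[where g = "\<lambda>s. \<lfloor>of_int d * s + c\<rfloor>"])
    show "?f \<in> {\<lceil>c\<rceil>..<\<lceil>c\<rceil> + d} \<rightarrow> ?S"
    proof
      fix k assume "k \<in> {\<lceil>c\<rceil>..<\<lceil>c\<rceil> + d}"
      then have "c \<le> of_int k" "of_int k < c + of_int d" by (auto simp: ceiling_le_iff) linarith
      then show "?f k \<in> ?S" using assms by (auto simp: field_simps)
    qed
    show "(\<lambda>s. \<lfloor>of_int d * s + c\<rfloor>) \<in> ?S \<rightarrow> {\<lceil>c\<rceil>..<\<lceil>c\<rceil> + d}"
    proof
      fix s assume s: "s \<in> ?S"
      then obtain k where k: "of_int d * s + c = of_int k" by (auto elim: Ints_cases)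
      have "0 \<le> of_int d * s" "of_int d * s < of_int d * 1"
        using s assms by (auto simp del: mult_1_right)
      then have "c \<le> of_int k" "of_int k < c + of_int d" using k by linarith+
      then show "\<lfloor>of_int d * s + c\<rfloor> \<in> {\<lceil>c\<rceil>..<\<lceil>c\<rceil> + d}"
        unfolding k by (simp add: ceiling_le_iff) linarith
    qed
    show "\<lfloor>of_int d * ?f k + c\<rfloor> = k" if "k \<in> {\<lceil>c\<rceil>..<\<lceil>c\<rceil> + d}" for k using assms by simp
    show "?f \<lfloor>of_int d * s + c\<rfloor> = s" if s: "s \<in> ?S" for s
      using s assms by (auto elim!: Ints_cases simp: field_simps)
  qed
  from bij_betw_same_card[OF this] show ?thesis by simp
qed

section \<open>Integer points of a box modulo the row lattice\<close>

locale integer_matrix =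
  fixes n :: nat and a :: "nat \<Rightarrow> nat \<Rightarrow> int"
begin

definition row_comb :: "(nat \<Rightarrow> real) \<Rightarrow> nat \<Rightarrow> real" where
  "row_comb y j = (\<Sum>i<n. y i * of_int (a i j))"

text \<open>
  Independence of the rows of \<open>A\<^sub>S\<close>, the form in which spanning enters all counts.
\<close>

definition full_rank_on :: "nat set \<Rightarrow> bool" where
  "full_rank_on S \<longleftrightarrow> (\<forall>y. (\<forall>j\<in>S. row_comb y j = 0) \<longrightarrow> (\<forall>i<n. y i = 0))"

definition row_cong :: "nat set \<Rightarrow> ((nat \<Rightarrow> int) \<times> (nat \<Rightarrow> int)) set" where
  "row_cong S = {(x, x'). \<exists>z::nat \<Rightarrow> int.
     \<forall>j\<in>S. real_of_int (x j - x' j) = row_comb (\<lambda>i. of_int (z i)) j}"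

text \<open>
  The real point \<open>y\<close> witnesses that \<open>x\<close>, read on the coordinates in \<open>S\<close>, lies in the box \<open>[0,t]\<^sup>T \<times> {0}\<close> plus the
  row space of \<open>A\<^sub>S\<close>. Integer vectors are functions on all of \<open>\<nat>\<close>; only their values on \<open>S\<close> are ever
  looked at, so that passing to a smaller \<open>S\<close> is the contraction of the forgotten coordinates.
\<close>

definition in_box :: "nat \<Rightarrow> nat set \<Rightarrow> nat set \<Rightarrow> (nat \<Rightarrow> int) \<Rightarrow> (nat \<Rightarrow> real) \<Rightarrow> bool" where
  "in_box t T S x y \<longleftrightarrow>
     (\<forall>j\<in>S. if j \<in> T then 0 \<le> of_int (x j) - row_comb y j \<and> of_int (x j) - row_comb y j \<le> real t
            else of_int (x j) = row_comb y j)"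

definition box_classes :: "nat \<Rightarrow> nat set \<Rightarrow> nat set \<Rightarrow> (nat \<Rightarrow> int) set set" where
  "box_classes t T S = {x. \<exists>y. in_box t T S x y} // row_cong S"

text \<open>
  Representatives for the saturation of the row lattice of \<open>A\<^sub>S\<close> modulo the row lattice itself,
  provided that \<open>A\<^sub>S\<close> has full rank.
\<close>

definition torsion_points :: "nat set \<Rightarrow> (nat \<Rightarrow> real) set" where
  "torsion_points S = {y \<in> {..<n} \<rightarrow>\<^sub>E {0..<1}. \<forall>j\<in>S. row_comb y j \<in> \<int>}"

lemma row_comb_add: "row_comb (\<lambda>i. y i + z i) j = row_comb y j + row_comb z j"
  and row_comb_diff: "row_comb (\<lambda>i. y i - z i) j = row_comb y j - row_comb z j"
  and row_comb_scale: "row_comb (\<lambda>i. c * y i) j = c * row_comb y j"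
  and row_comb_minus: "row_comb (\<lambda>i. - y i) j = - row_comb y j"
  and row_comb_0: "row_comb (\<lambda>i. 0) j = 0"
  by (simp_all add: row_comb_def algebra_simps sum.distrib sum_subtractf sum_distrib_left
      flip: sum_negf)

lemma row_comb_cong: "(\<And>i. i < n \<Longrightarrow> y i = z i) \<Longrightarrow> row_comb y j = row_comb z j"
  by (simp add: row_comb_def)

lemma row_comb_of_int: "row_comb (\<lambda>i. of_int (z i)) j = of_int (\<Sum>i<n. z i * a i j)"
  by (simp add: row_comb_def)

lemma full_rank_on_mono: "full_rank_on S \<Longrightarrow> S \<subseteq> S' \<Longrightarrow> full_rank_on S'"
  by (auto simp: full_rank_on_def)

lemma full_rank_onD:
  assumes "full_rank_on S" and "\<And>j. j \<in> S \<Longrightarrow> row_comb y j = row_comb z j" and "i < n"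
  shows "y i = z i"
proof -
  have "\<forall>j\<in>S. row_comb (\<lambda>i. y i - z i) j = 0" using assms(2) by (simp add: row_comb_diff)
  then have "y i - z i = 0" using assms(1,3) unfolding full_rank_on_def by blast
  then show ?thesis by simp
qed

lemma row_cong_iff: "(x, x') \<in> row_cong S \<longleftrightarrow>
    (\<exists>z::nat \<Rightarrow> int. \<forall>j\<in>S. real_of_int (x j - x' j) = row_comb (\<lambda>i. of_int (z i)) j)"
  by (simp add: row_cong_def)

lemma equiv_row_cong: "equiv UNIV (row_cong S)"
proof (rule equivI)
  show "row_cong S \<subseteq> UNIV \<times> UNIV" by simp
  show "refl (row_cong S)"
    by (rule refl_onI) (auto simp: row_cong_iff row_comb_0 intro!: exI[of _ "\<lambda>_. 0"])
  show "sym (row_cong S)"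
  proof (rule symI)
    fix x x' assume "(x, x') \<in> row_cong S"
    then obtain z :: "nat \<Rightarrow> int"
      where z: "\<forall>j\<in>S. real_of_int (x j - x' j) = row_comb (\<lambda>i. of_int (z i)) j"
      by (auto simp: row_cong_iff)
    then have "\<forall>j\<in>S. real_of_int (x' j - x j) = row_comb (\<lambda>i. of_int (- z i)) j"
      by (auto simp: row_comb_minus algebra_simps)
    then show "(x', x) \<in> row_cong S"
      unfolding row_cong_iff by (intro exI[of _ "\<lambda>i. - z i"])
  qed
  show "trans (row_cong S)"
  proof (rule transI)
    fix x x' x'' assume "(x, x') \<in> row_cong S" "(x', x'') \<in> row_cong S"
    then obtain z z' :: "nat \<Rightarrow> int"
      where "\<forall>j\<in>S. real_of_int (x j - x' j) = row_comb (\<lambda>i. of_int (z i)) j"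
        and "\<forall>j\<in>S. real_of_int (x' j - x'' j) = row_comb (\<lambda>i. of_int (z' i)) j"
      by (auto simp: row_cong_iff)
    then have "\<forall>j\<in>S. real_of_int (x j - x'' j) = row_comb (\<lambda>i. of_int (z i + z' i)) j"
      by (auto simp: row_comb_add algebra_simps)
    then show "(x, x'') \<in> row_cong S"
      unfolding row_cong_iff by (intro exI[of _ "\<lambda>i. z i + z' i"])
  qed
qed

lemma row_cong_class_eq_iff: "row_cong S `` {x} = row_cong S `` {x'} \<longleftrightarrow> (x, x') \<in> row_cong S"
  by (simp add: eq_equiv_class_iff[OF equiv_row_cong])

lemma in_box_row_cong:
  assumes "in_box t T S x y" "(x, x') \<in> row_cong S"
  shows "\<exists>y'. in_box t T S x' y'"
proof -
  obtain z :: "nat \<Rightarrow> int"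
    where z: "\<And>j. j \<in> S \<Longrightarrow> real_of_int (x j - x' j) = row_comb (\<lambda>i. of_int (z i)) j"
    using assms(2) by (auto simp: row_cong_iff)
  have "real_of_int (x' j) - row_comb (\<lambda>i. y i - of_int (z i)) j = of_int (x j) - row_comb y j"
    if "j \<in> S" for j
    using z[OF that] by (simp add: row_comb_diff)
  then have "in_box t T S x' (\<lambda>i. y i - of_int (z i))"
    using assms(1) unfolding in_box_def by (smt (verit))
  then show ?thesis by blast
qed

lemma in_box_iff_class_in_box_classes:
  "row_cong S `` {x} \<in> box_classes t T S \<longleftrightarrow> (\<exists>y. in_box t T S x y)"
proof
  assume "row_cong S `` {x} \<in> box_classes t T S"
  then obtain x' y where x': "in_box t T S x' y" "row_cong S `` {x} = row_cong S `` {x'}"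
    unfolding box_classes_def quotient_def by auto
  then have "(x', x) \<in> row_cong S" using row_cong_class_eq_iff by metis
  then show "\<exists>y. in_box t T S x y" using in_box_row_cong x'(1) by blast
qed (auto simp: box_classes_def intro: quotientI)

text \<open>
  Subtracting the combination of the rows with coefficients \<open>\<lfloor>y i\<rfloor>\<close> leaves a representative whose
  entries are bounded by the column sums of \<open>\<bar>a\<bar>\<close> plus \<open>t\<close>.
\<close>

lemma finite_box_classes:
  assumes "finite S"
  shows "finite (box_classes t T S)"
proof -
  define b where "b j = (\<Sum>i<n. \<bar>a i j\<bar>) + int t" for j
  let ?R = "PiE S (\<lambda>j. {- b j..b j})"
  have "box_classes t T S \<subseteq> (\<lambda>x. row_cong S `` {x}) ` ?R"
  proof
    fix q assume "q \<in> box_classes t T S"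
    then obtain x y where q: "q = row_cong S `` {x}" and xy: "in_box t T S x y"
      unfolding box_classes_def quotient_def by auto
    define x' where
      "x' j = (if j \<in> S then x j - (\<Sum>i<n. \<lfloor>y i\<rfloor> * a i j) else undefined)" for j
    have "(x, x') \<in> row_cong S"
      unfolding row_cong_iff
      by (rule exI[of _ "\<lambda>i. \<lfloor>y i\<rfloor>"]) (simp add: x'_def row_comb_of_int)
    then have "q = row_cong S `` {x'}" using q row_cong_class_eq_iff by blast
    moreover have "x' j \<in> {- b j..b j}" if "j \<in> S" for j
    proof -
      have "real_of_int (x' j) = (of_int (x j) - row_comb y j) + row_comb (\<lambda>i. frac (y i)) j"
        using that by (simp add: x'_def frac_def row_comb_diff row_comb_of_int)
      moreover have "\<bar>of_int (x j) - row_comb y j\<bar> \<le> real t"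
        using xy that unfolding in_box_def by (smt (verit) of_nat_0_le_iff)
      moreover have "\<bar>row_comb (\<lambda>i. frac (y i)) j\<bar> \<le> (\<Sum>i<n. real_of_int \<bar>a i j\<bar>)"
        unfolding row_comb_def
      proof (rule order_trans[OF sum_abs], rule sum_mono)
        fix i
        show "\<bar>frac (y i) * real_of_int (a i j)\<bar> \<le> real_of_int \<bar>a i j\<bar>"
          using frac_ge_0[of "y i"] frac_lt_1[of "y i"]
          by (simp add: abs_mult mult_left_le_one_le)
      qed
      ultimately have "\<bar>real_of_int (x' j)\<bar> \<le> of_int (b j)"
        by (simp add: b_def)
      then show ?thesis by (simp flip: of_int_abs add: abs_le_iff)
    qed
    then have "x' \<in> ?R" by (auto simp: x'_def intro!: PiE_I)
    ultimately show "q \<in> (\<lambda>x. row_cong S `` {x}) ` ?R" by blast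
  qed
  moreover have "finite ?R" using assms by (intro finite_PiE) auto
  ultimately show ?thesis by (meson finite_imageI finite_subset)
qed

end

section \<open>Deletion and contraction\<close>

context integer_matrix
begin


lemma row_cong_shift_iff:
  assumes "i \<in> S"
  shows "(x(i := x i + k), x') \<in> row_cong S \<longleftrightarrow>
    (\<exists>z::nat \<Rightarrow> int. (\<forall>j\<in>S - {i}. real_of_int (x j - x' j) = row_comb (\<lambda>i. of_int (z i)) j)
        \<and> real_of_int (x i + k - x' i) = row_comb (\<lambda>i. of_int (z i)) i)"
proof -
  have split: "(\<forall>j\<in>S. P j) \<longleftrightarrow> (\<forall>j\<in>S - {i}. P j) \<and> P i" for P
    using assms by auto
  show ?thesis
    unfolding row_cong_iff split by (intro ex_cong1 conj_cong ball_cong) auto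
qed

text \<open>
  Forgetting the coordinate \<open>i\<close> maps classes on \<open>S\<close> to classes on \<open>S - {i}\<close>. Since the rows are still
  independent on \<open>S - {i}\<close>, the classes above that of \<open>x\<close> are those of the points
  \<open>x + k e\<^sub>i\<close>, and they are distinct for distinct integers \<open>k\<close>. The function \<open>\<rho>\<close> selects the representatives \<open>x\<close>.
\<close>

lemma bij_betw_fibres_contraction:
  assumes i: "i \<in> S" and full: "full_rank_on (S - {i})"
    and \<rho>: "\<And>q. q \<in> box_classes t T (S - {i}) \<Longrightarrow> q = row_cong (S - {i}) `` {\<rho> q}"
  shows "bij_betw (\<lambda>(q, k). row_cong S `` {(\<rho> q)(i := \<rho> q i + k)})
    (SIGMA q:box_classes t T (S - {i}). {k. \<exists>y. in_box t T S ((\<rho> q)(i := \<rho> q i + k)) y})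
    (box_classes t T S)"
proof -
  let ?S = "S - {i}"
  let ?f = "\<lambda>(q, k). row_cong S `` {(\<rho> q)(i := \<rho> q i + k)}"
  let ?P = "SIGMA q:box_classes t T ?S. {k. \<exists>y. in_box t T S ((\<rho> q)(i := \<rho> q i + k)) y}"
  have "inj_on ?f ?P"
  proof (rule inj_onI, clarsimp)
    fix q k y q' k' y'
    assume q: "q \<in> box_classes t T ?S" and q': "q' \<in> box_classes t T ?S"
      and "row_cong S `` {(\<rho> q)(i := \<rho> q i + k)} = row_cong S `` {(\<rho> q')(i := \<rho> q' i + k')}"
    then have "((\<rho> q)(i := \<rho> q i + k), (\<rho> q')(i := \<rho> q' i + k')) \<in> row_cong S"
      by (simp add: row_cong_class_eq_iff)
    then obtain z :: "nat \<Rightarrow> int"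
      where z: "\<And>j. j \<in> ?S \<Longrightarrow> real_of_int (\<rho> q j - \<rho> q' j) = row_comb (\<lambda>i. of_int (z i)) j"
        "real_of_int (\<rho> q i + k - (\<rho> q' i + k')) = row_comb (\<lambda>i. of_int (z i)) i"
      unfolding row_cong_shift_iff[OF i] by auto
    have "(\<rho> q, \<rho> q') \<in> row_cong ?S" using z(1) unfolding row_cong_iff by blast
    then have eq: "row_cong ?S `` {\<rho> q} = row_cong ?S `` {\<rho> q'}"
      by (simp add: row_cong_class_eq_iff)
    have qq: "q = q'" by (rule trans[OF \<rho>[OF q] trans[OF eq \<rho>[OF q', symmetric]]])
    have "real_of_int (z l) = 0" if "l < n" for l
      using full_rank_onD[OF full, of "\<lambda>i. real_of_int (z i)" "\<lambda>_. 0"] z(1) qq that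
      by (simp add: row_comb_0)
    then have "row_comb (\<lambda>i. of_int (z i)) i = 0" by (simp add: row_comb_def)
    then show "q = q' \<and> k = k'" using z(2) qq by simp
  qed
  moreover have "?f ` ?P = box_classes t T S"
  proof (intro equalityI subsetI)
    fix c assume "c \<in> ?f ` ?P"
    then obtain q k y where "c = row_cong S `` {(\<rho> q)(i := \<rho> q i + k)}"
      and y: "in_box t T S ((\<rho> q)(i := \<rho> q i + k)) y"
      by auto
    then show "c \<in> box_classes t T S"
      using in_box_iff_class_in_box_classes by blast
  next
    fix c assume "c \<in> box_classes t T S"
    then obtain x y where c: "c = row_cong S `` {x}" and y: "in_box t T S x y"
      unfolding box_classes_def quotient_def by auto
    define q where "q = row_cong ?S `` {x}"
    have "in_box t T ?S x y" using y unfolding in_box_def by auto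
    then have q: "q \<in> box_classes t T ?S"
      unfolding q_def in_box_iff_class_in_box_classes by blast
    have "(\<rho> q, x) \<in> row_cong ?S"
      unfolding row_cong_class_eq_iff[symmetric]
      by (rule trans[OF \<rho>[OF q, symmetric] q_def])
    then obtain z :: "nat \<Rightarrow> int"
      where z: "\<And>j. j \<in> ?S \<Longrightarrow> real_of_int (\<rho> q j - x j) = row_comb (\<lambda>i. of_int (z i)) j"
      unfolding row_cong_iff by blast
    define k where "k = x i + (\<Sum>l<n. z l * a l i) - \<rho> q i"
    have "((\<rho> q)(i := \<rho> q i + k), x) \<in> row_cong S"
      unfolding row_cong_shift_iff[OF i]
      by (rule exI[of _ z]) (use z in \<open>auto simp: k_def row_comb_of_int\<close>)
    then have cc: "c = row_cong S `` {(\<rho> q)(i := \<rho> q i + k)}"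
      unfolding c row_cong_class_eq_iff[symmetric] by (rule sym)
    have "\<exists>y. in_box t T S ((\<rho> q)(i := \<rho> q i + k)) y"
      using \<open>c \<in> box_classes t T S\<close> unfolding cc in_box_iff_class_in_box_classes .
    then have "(q, k) \<in> ?P" using q by simp
    then show "c \<in> ?f ` ?P" by (rule image_eqI[rotated]) (simp add: cc)
  qed
  ultimately show ?thesis by (simp add: bij_betw_def)
qed

text \<open>
  Above every class on \<open>S - {i}\<close>, the integers \<open>k\<close> that are admissible for \<open>T\<close> are those of a nonempty convex set \<open>K\<close>
  of reals, and those admissible for \<open>insert i T\<close> are the integers of \<open>K + [0,t]\<close>. So every fibre
  grows by exactly \<open>t\<close>. That \<open>K\<close> contains only finitely many integers follows from the finiteness of the
  set of all classes.
\<close>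

lemma card_box_classes_insert_full:
  assumes fin: "finite S" and i: "i \<in> S" "i \<notin> T" and full: "full_rank_on (S - {i})"
  shows "card (box_classes t (insert i T) S)
    = card (box_classes t T S) + t * card (box_classes t T (S - {i}))"
proof -
  let ?S = "S - {i}" and ?Q = "box_classes t T (S - {i})"
  define \<rho> where "\<rho> q = (SOME x. q = row_cong ?S `` {x})" for q
  have \<rho>: "q = row_cong ?S `` {\<rho> q}" if "q \<in> box_classes t T' ?S" for q T'
  proof -
    have "\<exists>x. q = row_cong ?S `` {x}" using that unfolding box_classes_def quotient_def by auto
    then show ?thesis unfolding \<rho>_def by (rule someI_ex)
  qed
  let ?x = "\<lambda>q k. (\<rho> q)(i := \<rho> q i + k)"
  let ?k = "\<lambda>T' q. {k. \<exists>y. in_box t T' S (?x q k) y}"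
  have Q: "box_classes t (insert i T) ?S = ?Q"
  proof -
    have "in_box t (insert i T) ?S = in_box t T ?S"
      by (intro ext) (auto simp: in_box_def)
    then show ?thesis unfolding box_classes_def by simp
  qed
  have finQ: "finite ?Q" using fin by (simp add: finite_box_classes)
  have bij: "bij_betw (\<lambda>(q, k). row_cong S `` {?x q k}) (SIGMA q:?Q. ?k T' q) (box_classes t T' S)"
    if "T' = T \<or> T' = insert i T" for T'
    using bij_betw_fibres_contraction[OF i(1) full \<rho>, of t T'] that Q by auto
  have fink: "finite (?k T' q)" if "q \<in> ?Q" "T' = T \<or> T' = insert i T" for T' q
  proof -
    have "finite (SIGMA q:?Q. ?k T' q)"
      using bij_betw_finite[OF bij[OF that(2)]] fin by (simp add: finite_box_classes)
    moreover have "Pair q ` ?k T' q \<subseteq> (SIGMA q:?Q. ?k T' q)" using that by auto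
    ultimately have "finite (Pair q ` ?k T' q)" by (rule rev_finite_subset)
    then show ?thesis by (rule finite_imageD) (simp add: inj_on_def)
  qed
  have count: "card (box_classes t T' S) = (\<Sum>q\<in>?Q. card (?k T' q))"
    if "T' = T \<or> T' = insert i T" for T'
    using bij_betw_same_card[OF bij[OF that]] finQ fink[OF _ that] by simp
  have fibre: "card (?k (insert i T) q) = card (?k T q) + t" if q: "q \<in> ?Q" for q
  proof -
    \<comment> \<open>the positions on the line \<open>\<rho> q + \<real> e\<^sub>i\<close> that meet the box over \<open>T\<close> plus the row space\<close>
    define K where "K = {row_comb y i - of_int (\<rho> q i) | y. in_box t T ?S (\<rho> q) y}"
    have k1: "?k T q = {k. of_int k \<in> K}"
    proof -
      have "in_box t T S (?x q k) y \<longleftrightarrow>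
          in_box t T ?S (\<rho> q) y \<and> of_int k = row_comb y i - of_int (\<rho> q i)" for k y
        using i unfolding in_box_def by (auto split: if_splits)
      then show ?thesis unfolding K_def by auto
    qed
    have k2: "?k (insert i T) q = {k. \<exists>s\<in>K. s \<le> of_int k \<and> of_int k \<le> s + real t}"
    proof -
      have "in_box t (insert i T) S (?x q k) y \<longleftrightarrow>
          in_box t T ?S (\<rho> q) y \<and> row_comb y i - of_int (\<rho> q i) \<le> of_int k
            \<and> of_int k \<le> row_comb y i - of_int (\<rho> q i) + real t" for k y
        using i unfolding in_box_def by (auto split: if_splits)
      then show ?thesis unfolding K_def by auto
    qed
    have "row_cong ?S `` {\<rho> q} \<in> ?Q" by (rule subst[OF \<rho>[OF q], of "\<lambda>c. c \<in> ?Q", OF q])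
    then have "K \<noteq> {}"
      unfolding in_box_iff_class_in_box_classes K_def by auto
    moreover have "s \<in> K" if "u \<in> K" "v \<in> K" and s: "u \<le> s" "s \<le> v" for u v s
    proof -
      obtain y y' where y: "in_box t T ?S (\<rho> q) y" "u = row_comb y i - of_int (\<rho> q i)"
        and y': "in_box t T ?S (\<rho> q) y'" "v = row_comb y' i - of_int (\<rho> q i)"
        using \<open>u \<in> K\<close> \<open>v \<in> K\<close> unfolding K_def by auto
      obtain c where c: "0 \<le> c" "c \<le> 1" "s = (1 - c) * u + c * v"
      proof (cases "u = v")
        case True
        then show ?thesis using s that[of 0] by simp
      next
        case False
        then have "u < v" using s by simp
        define c where "c = (s - u) / (v - u)"
        have "c * (v - u) = s - u" "0 \<le> c" "c \<le> 1"
          using \<open>u < v\<close> s by (simp_all add: c_def)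
        then show ?thesis using that[of c] by (simp add: algebra_simps)
      qed
      define w where "w l = (1 - c) * y l + c * y' l" for l
      have w: "row_comb w j = (1 - c) * row_comb y j + c * row_comb y' j" for j
        unfolding w_def row_comb_add row_comb_scale ..
      have cw: "of_int m - row_comb w j
          = (1 - c) * (of_int m - row_comb y j) + c * (of_int m - row_comb y' j)" for m j
        unfolding w by (simp add: algebra_simps)
      have conv: "0 \<le> (1 - c) * p + c * p' \<and> (1 - c) * p + c * p' \<le> real t"
        if "0 \<le> p" "p \<le> real t" "0 \<le> p'" "p' \<le> real t" for p p'
        using that c convex_bound_le[of p "real t" p' "1 - c" c] by simp
      have "in_box t T ?S (\<rho> q) w"
        unfolding in_box_def
      proof
        fix j assume j: "j \<in> ?S"
        show "if j \<in> T then 0 \<le> of_int (\<rho> q j) - row_comb w j \<and> of_int (\<rho> q j) - row_comb w j \<le> real t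
          else of_int (\<rho> q j) = row_comb w j"
        proof (cases "j \<in> T")
          case True
          have "0 \<le> of_int (\<rho> q j) - row_comb y j" "of_int (\<rho> q j) - row_comb y j \<le> real t"
            "0 \<le> of_int (\<rho> q j) - row_comb y' j" "of_int (\<rho> q j) - row_comb y' j \<le> real t"
            using y(1)[unfolded in_box_def, THEN bspec, OF j]
              y'(1)[unfolded in_box_def, THEN bspec, OF j] True by simp_all
          from conv[OF this] show ?thesis unfolding cw using True by (simp only: if_True)
        next
          case False
          then have "of_int (\<rho> q j) = row_comb y j" "of_int (\<rho> q j) = row_comb y' j"
            using y(1)[unfolded in_box_def, THEN bspec, OF j]
              y'(1)[unfolded in_box_def, THEN bspec, OF j] False by simp_all
          then show ?thesis using False unfolding w by (simp add: algebra_simps)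
        qed
      qed
      moreover have "s = row_comb w i - of_int (\<rho> q i)"
        unfolding c(3) y(2) y'(2) w by (simp add: algebra_simps)
      ultimately show ?thesis unfolding K_def by blast
    qed
    ultimately show ?thesis
      using card_integers_interval_extension(2)[of K t] fink[OF q, of T] unfolding k1 k2 by blast
  qed
  have "card (box_classes t (insert i T) S) = (\<Sum>q\<in>?Q. card (?k T q) + t)"
    using count[of "insert i T"] fibre by simp
  also have "\<dots> = card (box_classes t T S) + t * card ?Q"
    using count[of T] by (simp add: sum.distrib)
  finally show ?thesis .
qed

text \<open>
  If the rows become dependent on \<open>S - {i}\<close>, some combination of them is a nonzero multiple of the \<open>i\<close>-th unit
  vector on \<open>S\<close>. Adding a multiple of it to the witness \<open>y\<close> corrects the coordinate \<open>i\<close> without touching the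
  others.
\<close>

lemma box_classes_insert_coloop:
  assumes i: "i \<in> S" "i \<notin> T" and full: "full_rank_on S" "\<not> full_rank_on (S - {i})"
  shows "box_classes t (insert i T) S = box_classes t T S"
proof -
  obtain y0 where y0: "\<And>j. j \<in> S - {i} \<Longrightarrow> row_comb y0 j = 0" and ne: "\<not> (\<forall>l<n. y0 l = 0)"
    using full(2) unfolding full_rank_on_def by auto
  have "row_comb y0 i \<noteq> 0"
  proof
    assume "row_comb y0 i = 0"
    then have "\<forall>j\<in>S. row_comb y0 j = 0" using y0 by blast
    then show False using full(1) ne unfolding full_rank_on_def by blast
  qed
  have "(\<exists>y. in_box t (insert i T) S x y) \<longleftrightarrow> (\<exists>y. in_box t T S x y)" for x
  proof
    assume "\<exists>y. in_box t (insert i T) S x y"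
    then obtain y where y: "in_box t (insert i T) S x y" ..
    define c where "c = (of_int (x i) - row_comb y i) / row_comb y0 i"
    have w: "row_comb (\<lambda>l. y l + c * y0 l) j = (if j = i then of_int (x i) else row_comb y j)"
      if "j \<in> S" for j
    proof -
      have "row_comb (\<lambda>l. y l + c * y0 l) j = row_comb y j + c * row_comb y0 j"
        by (simp add: row_comb_add row_comb_scale)
      then show ?thesis using that y0 \<open>row_comb y0 i \<noteq> 0\<close> by (auto simp: c_def)
    qed
    have "in_box t T S x (\<lambda>l. y l + c * y0 l)"
      using y i unfolding in_box_def by (auto simp: w)
    then show "\<exists>y. in_box t T S x y" by blast
  next
    assume "\<exists>y. in_box t T S x y"
    then obtain y where y: "in_box t T S x y" ..
    then have "in_box t (insert i T) S x y" using i unfolding in_box_def by auto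
    then show "\<exists>y. in_box t (insert i T) S x y" by blast
  qed
  then show ?thesis unfolding box_classes_def by simp
qed

text \<open>
  Every real coefficient vector is, modulo \<open>\<int>\<^sup>n\<close>, congruent to exactly one in \<open>[0,1)\<^sup>n\<close>. The translate by \<open>x0\<close> is
  needed because the same count describes the classes over a single lattice point of the zonotope.
\<close>

lemma card_classes_of_saturated_coset:
  assumes full: "full_rank_on S"
  shows "card {row_cong S `` {x} | x. \<exists>y. \<forall>j\<in>S. real_of_int (x j - x0 j) = row_comb y j}
    = card (torsion_points S)" (is "card ?Q = _")
proof -
  let ?x = "\<lambda>y j. x0 j + \<lfloor>row_comb y j\<rfloor>"
  let ?f = "\<lambda>y. row_cong S `` {?x y}"
  have int: "of_int \<lfloor>row_comb y j\<rfloor> = row_comb y j" if "y \<in> torsion_points S" "j \<in> S" for y j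
    using that by (auto simp: torsion_points_def elim!: Ints_cases)
  have "inj_on ?f (torsion_points S)"
  proof (rule inj_onI)
    fix y y' assume y: "y \<in> torsion_points S" "y' \<in> torsion_points S" and "?f y = ?f y'"
    then have "(?x y, ?x y') \<in> row_cong S"
      by (simp add: row_cong_class_eq_iff)
    then obtain z :: "nat \<Rightarrow> int"
      where z: "\<And>j. j \<in> S \<Longrightarrow> row_comb y j - row_comb y' j = row_comb (\<lambda>i. of_int (z i)) j"
      unfolding row_cong_iff using int y by auto
    have yz: "y l - y' l = of_int (z l)" if "l < n" for l
      using full_rank_onD[OF full, of "\<lambda>l. y l - y' l" "\<lambda>l. of_int (z l)"] z that
      by (simp add: row_comb_diff)
    moreover have "0 \<le> y l" "y l < 1" "0 \<le> y' l" "y' l < 1" if "l < n" for l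
      using y that unfolding torsion_points_def PiE_def Pi_def by auto
    ultimately have "of_int (-1) < real_of_int (z l)" "real_of_int (z l) < of_int 1"
      if "l < n" for l
      using that by fastforce+
    then have "z l = 0" if "l < n" for l
      using that unfolding of_int_less_iff by fastforce
    then have "y l = y' l" if "l < n" for l
      using yz that by fastforce
    then show "y = y'"
      using y by (intro PiE_ext[of y "{..<n}" "\<lambda>_. {0..<1}" y']) (auto simp: torsion_points_def)
  qed
  moreover have "?f ` torsion_points S = ?Q"
  proof (intro equalityI subsetI)
    fix c assume "c \<in> ?f ` torsion_points S"
    then obtain y where y: "y \<in> torsion_points S" "c = ?f y" by blast
    have "\<forall>j\<in>S. real_of_int (?x y j - x0 j) = row_comb y j" using int[OF y(1)] by simp
    then show "c \<in> ?Q" unfolding y(2) by blast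
  next
    fix c assume "c \<in> ?Q"
    then obtain x y where c: "c = row_cong S `` {x}"
      and xy: "\<And>j. j \<in> S \<Longrightarrow> real_of_int (x j - x0 j) = row_comb y j"
      by auto
    define w where "w = restrict (\<lambda>l. frac (y l)) {..<n}"
    have wj: "row_comb w j = row_comb y j - row_comb (\<lambda>l. of_int \<lfloor>y l\<rfloor>) j" for j
      unfolding w_def row_comb_diff[symmetric] by (rule row_comb_cong) (simp add: frac_def)
    have "row_comb w j \<in> \<int>" if "j \<in> S" for j
      unfolding wj xy[OF that, symmetric] row_comb_of_int by (intro Ints_diff Ints_of_int)
    then have w: "w \<in> torsion_points S"
      unfolding torsion_points_def by (auto simp: w_def frac_lt_1)
    have "real_of_int (x j - ?x w j) = row_comb (\<lambda>l. of_int \<lfloor>y l\<rfloor>) j" if "j \<in> S" for j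
    proof -
      have "real_of_int (x j - ?x w j) = real_of_int (x j - x0 j) - of_int \<lfloor>row_comb w j\<rfloor>" by simp
      also have "\<dots> = row_comb (\<lambda>l. of_int \<lfloor>y l\<rfloor>) j"
        unfolding xy[OF that] trans[OF int[OF w that] wj[of j]] by simp
      finally show ?thesis .
    qed
    then have "(x, ?x w) \<in> row_cong S"
      unfolding row_cong_iff by (intro exI[of _ "\<lambda>l. \<lfloor>y l\<rfloor>"] ballI)
    then have "c = ?f w" unfolding c by (simp add: row_cong_class_eq_iff)
    then show "c \<in> ?f ` torsion_points S" using w by blast
  qed
  ultimately have "bij_betw ?f (torsion_points S) ?Q" by (simp add: bij_betw_def)
  then show ?thesis by (simp add: bij_betw_same_card)
qed

lemma card_box_classes_empty:
  assumes "full_rank_on S"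
  shows "card (box_classes t {} S) = card (torsion_points S)"
proof -
  have "box_classes t {} S
      = {row_cong S `` {x} | x. \<exists>y. \<forall>j\<in>S. real_of_int (x j - 0) = row_comb y j}"
    unfolding box_classes_def in_box_def quotient_def by auto
  then show ?thesis using card_classes_of_saturated_coset[OF assms, of "\<lambda>_. 0"] by simp
qed

text \<open>
  The recurrence unfolded: a summand arises for each choice of the coordinates \<open>C\<close> that were contracted
  rather than deleted. The contracted sets are those whose complement still spans, because
  once \<open>S - {i}\<close> fails to span, so do all its subsets.
\<close>

lemma card_box_classes_eq_sum:
  assumes "finite S" "T \<subseteq> S" "full_rank_on S"
  shows "card (box_classes t T S)
    = (\<Sum>C | C \<subseteq> T \<and> full_rank_on (S - C). t ^ card C * card (torsion_points (S - C)))"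
proof -
  have "finite T" by (rule finite_subset[OF assms(2,1)])
  then show ?thesis using assms
  proof (induction T arbitrary: S rule: finite_induct)
    case empty
    then have "{C. C \<subseteq> {} \<and> full_rank_on (S - C)} = {{}}" by auto
    then show ?case using empty by (simp add: card_box_classes_empty)
  next
    case (insert i T)
    let ?F = "\<lambda>T S. {C. C \<subseteq> T \<and> full_rank_on (S - C)}"
    let ?g = "\<lambda>S C. t ^ card C * card (torsion_points (S - C))"
    have i: "i \<in> S" "i \<notin> T" and TS: "T \<subseteq> S" "T \<subseteq> S - {i}" using insert by auto
    have finF: "finite (?F T S')" for S'
      by (rule finite_subset[of _ "Pow T"]) (use insert.hyps(1) in auto)
    have split: "?F (insert i T) S = ?F T S \<union> Set.insert i ` ?F T (S - {i})"
    proof (intro equalityI subsetI)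
      fix C assume C: "C \<in> ?F (insert i T) S"
      show "C \<in> ?F T S \<union> Set.insert i ` ?F T (S - {i})"
      proof (cases "i \<in> C")
        case True
        define C' where "C' = C - {i}"
        have CC': "C = Set.insert i C'" using True unfolding C'_def by auto
        have "C' \<subseteq> T" using C unfolding C'_def by auto
        moreover have "full_rank_on (S - {i} - C')"
          using C unfolding CC' Diff_insert2[of S i C', symmetric] by blast
        ultimately show ?thesis unfolding CC' by blast
      next
        case False
        then have "C \<in> ?F T S" using C by auto
        then show ?thesis by (rule UnI1)
      qed
    next
      fix C assume "C \<in> ?F T S \<union> Set.insert i ` ?F T (S - {i})"
      then show "C \<in> ?F (insert i T) S"
      proof
        assume "C \<in> Set.insert i ` ?F T (S - {i})"
        then obtain C' where C': "C = Set.insert i C'" "C' \<subseteq> T" "full_rank_on (S - {i} - C')" by auto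
        moreover have "S - C = S - {i} - C'" unfolding C'(1) by (rule Diff_insert2)
        ultimately show ?thesis by auto
      qed auto
    qed
    have inj: "inj_on (Set.insert i) (?F T (S - {i}))"
    proof (rule inj_onI)
      fix C C' assume "C \<in> ?F T (S - {i})" "C' \<in> ?F T (S - {i})"
        and eq: "Set.insert i C = Set.insert i C'"
      then have "i \<notin> C" "i \<notin> C'" using i(2) by auto
      then show "C = C'" using eq by (simp add: insert_ident)
    qed
    have gi: "?g S (Set.insert i C) = t * ?g (S - {i}) C" if "C \<in> ?F T (S - {i})" for C
    proof -
      have "finite C" "i \<notin> C"
        using that i(2) finite_subset[OF _ insert.hyps(1)] by auto
      then have "card (Set.insert i C) = Suc (card C)" by simp
      then show ?thesis by (simp only: Diff_insert2[of S i C] power_Suc mult.assoc)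
    qed
    have "sum (?g S) (?F (insert i T) S)
        = sum (?g S) (?F T S) + sum (?g S) (Set.insert i ` ?F T (S - {i}))"
      unfolding split by (rule sum.union_disjoint) (use finF i in auto)
    moreover have "sum (?g S) (Set.insert i ` ?F T (S - {i}))
        = t * sum (?g (S - {i})) (?F T (S - {i}))"
      unfolding sum.reindex[OF inj] sum_distrib_left o_def by (rule sum.cong[OF refl gi])
    ultimately have *: "sum (?g S) (?F (insert i T) S)
        = sum (?g S) (?F T S) + t * sum (?g (S - {i})) (?F T (S - {i}))"
      by (simp only:)
    have IH: "card (box_classes t T S) = sum (?g S) (?F T S)"
      by (rule insert.IH[OF insert.prems(1) TS(1) insert.prems(3)])
    show ?case
    proof (cases "full_rank_on (S - {i})")
      case True
      have "card (box_classes t T (S - {i})) = sum (?g (S - {i})) (?F T (S - {i}))"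
        by (rule insert.IH[OF _ TS(2) True]) (simp add: insert.prems(1))
      then show ?thesis
        unfolding * card_box_classes_insert_full[OF insert.prems(1) i True] IH by simp
    next
      case False
      have "C \<notin> ?F T (S - {i})" for C
      proof
        assume "C \<in> ?F T (S - {i})"
        then have "full_rank_on (S - {i} - C)" by simp
        then have "full_rank_on (S - {i})" by (rule full_rank_on_mono) blast
        then show False using False by contradiction
      qed
      then have "sum (?g (S - {i})) (?F T (S - {i})) = 0" by (intro sum.neutral) blast
      then show ?thesis
        unfolding * box_classes_insert_coloop[OF i insert.prems(3) False] IH
        by (simp only: mult_0_right add_0_right)
    qed
  qed
qed

end

section \<open>Triangular bases of the column lattice\<close>

text \<open>
  Gaussian elimination without division: the last nonzero entry of \<open>x\<close> is cancelled by a
  multiple of the basis vector that ends at that place. Over \<open>\<int>\<close> the divisibility hypothesis says that the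
  diagonal entries generate the ideals of leading entries; over a field it says that they are
  nonzero.
\<close>

lemma triangular_reduction:
  fixes v :: "nat \<Rightarrow> nat \<Rightarrow> 'a::comm_ring_1" and G :: "(nat \<Rightarrow> 'a) set"
  assumes diff: "\<And>x y c. x \<in> G \<Longrightarrow> y \<in> G \<Longrightarrow> (\<lambda>i. x i - c * y i) \<in> G"
    and mem: "\<And>j. j < n \<Longrightarrow> v j \<in> G"
    and tri: "\<And>i j. j < i \<Longrightarrow> i < n \<Longrightarrow> v j i = 0"
    and dvd: "\<And>j x. j < n \<Longrightarrow> x \<in> G \<Longrightarrow> (\<And>i. j < i \<Longrightarrow> i < n \<Longrightarrow> x i = 0) \<Longrightarrow> v j j dvd x j"
    and x: "x \<in> G"
  shows "\<exists>c. \<forall>i<n. x i = (\<Sum>j<n. c j * v j i)"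
proof -
  have "\<exists>c. \<forall>i<n. x i = (\<Sum>j<k. c j * v j i)"
    if "k \<le> n" "x \<in> G" "\<And>i. k \<le> i \<Longrightarrow> i < n \<Longrightarrow> x i = 0" for k x
    using that
  proof (induction k arbitrary: x)
    case 0
    then show ?case by simp
  next
    case (Suc k)
    have "v k k dvd x k" by (rule dvd) (use Suc.prems in auto)
    then obtain q where q: "x k = v k k * q" by (elim dvdE)
    define x' where "x' i = x i - q * v k i" for i
    have "x' \<in> G" unfolding x'_def by (rule diff) (use Suc.prems mem in auto)
    moreover have "x' i = 0" if "k \<le> i" "i < n" for i
    proof (cases "i = k")
      case True
      then show ?thesis by (simp add: x'_def q)
    next
      case False
      then show ?thesis using that Suc.prems(3) tri by (simp add: x'_def)
    qed
    ultimately obtain c where c: "\<And>i. i < n \<Longrightarrow> x' i = (\<Sum>j<k. c j * v j i)"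
      using Suc.IH[of x'] Suc.prems(1) by auto
    have "x i = (\<Sum>j<Suc k. (c(k := q)) j * v j i)" if "i < n" for i
    proof -
      have "(\<Sum>j<k. (c(k := q)) j * v j i) = (\<Sum>j<k. c j * v j i)"
        by (rule sum.cong) auto
      then show ?thesis using c[OF that] by (simp add: x'_def diff_eq_eq)
    qed
    then show ?case by blast
  qed
  from this[of n x] x show ?thesis by simp
qed

text \<open>
  The \<open>j\<close>-th entries of those members of \<open>G\<close> that vanish beyond \<open>j\<close> form an ideal of \<open>\<int>\<close>, and \<open>v\<close> realizes a generator.
\<close>

lemma triangular_generators:
  fixes G :: "(nat \<Rightarrow> int) set"
  assumes diff: "\<And>x y c. x \<in> G \<Longrightarrow> y \<in> G \<Longrightarrow> (\<lambda>i. x i - c * y i) \<in> G"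
    and zero: "(\<lambda>_. 0) \<in> G"
  shows "\<exists>v\<in>G. (\<forall>i. j < i \<longrightarrow> i < n \<longrightarrow> v i = 0) \<and> 0 \<le> v j \<and>
    (\<forall>x\<in>G. (\<forall>i. j < i \<longrightarrow> i < n \<longrightarrow> x i = 0) \<longrightarrow> v j dvd x j)"
proof -
  let ?G = "{x \<in> G. \<forall>i. j < i \<longrightarrow> i < n \<longrightarrow> x i = 0}"
  have diff': "(\<lambda>i. x i - c * y i) \<in> ?G" if "x \<in> ?G" "y \<in> ?G" for x y c
    using that diff by auto
  show ?thesis
  proof (cases "\<exists>x\<in>?G. x j \<noteq> 0")
    case False
    then show ?thesis by (intro bexI[OF _ zero]) auto
  next
    case True
    then obtain x0 where x0: "x0 \<in> ?G" "x0 j \<noteq> 0" by blast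
    define P where "P d \<longleftrightarrow> d > 0 \<and> (\<exists>x\<in>?G. x j = int d)" for d
    have "\<exists>d. P d"
    proof (cases "x0 j > 0")
      case True
      then show ?thesis using x0 unfolding P_def
        by (intro exI[of _ "nat (x0 j)"] conjI bexI[of _ x0]) auto
    next
      case False
      have "(\<lambda>i. 0 - 1 * x0 i) \<in> ?G" by (rule diff'[OF _ x0(1)]) (use zero in simp)
      then show ?thesis using x0(2) False unfolding P_def
        by (intro exI[of _ "nat (- x0 j)"] conjI bexI[of _ "\<lambda>i. 0 - 1 * x0 i"]) auto
    qed
    define d where "d = (LEAST d. P d)"
    have d: "P d" and least: "\<And>e. P e \<Longrightarrow> d \<le> e"
      unfolding d_def using \<open>\<exists>d. P d\<close> by (auto intro: LeastI_ex Least_le)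
    from d obtain v where v: "v \<in> ?G" "v j = int d" "d > 0" unfolding P_def by blast
    have "v j dvd x j" if "x \<in> ?G" for x
    proof (rule ccontr)
      assume nd: "\<not> v j dvd x j"
      define y where "y = (\<lambda>i. x i - (x j div v j) * v i)"
      have y: "y \<in> ?G" unfolding y_def by (rule diff'[OF that v(1)])
      have yj: "y j = x j mod v j" unfolding y_def by (simp add: minus_div_mult_eq_mod)
      have "y j > 0" using nd v(2,3) unfolding yj
        by (metis dvd_eq_mod_eq_0 of_nat_0_less_iff order_le_less pos_mod_sign)
      moreover have "y j < int d" unfolding yj v(2) using v(3) by simp
      ultimately have "P (nat (y j))" "nat (y j) < d"
        unfolding P_def using y by (auto intro!: bexI[of _ y])
      then show False using least by fastforce
    qed
    moreover have "v \<in> G" using v(1) by simp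
    ultimately show ?thesis by (intro bexI[of _ v]) (use v in auto)
  qed
qed

text \<open>
  The coordinates of \<open>y\<close> can be chosen one after the other: once \<open>y 0, \<dots>, y (k - 1)\<close> are fixed, the \<open>k\<close>-th condition is an
  affine one on \<open>y k\<close> with slope \<open>v k k\<close>, so that it has \<open>v k k\<close> solutions in \<open>[0,1)\<close>.
\<close>

lemma card_triangular_integral_points:
  fixes v :: "nat \<Rightarrow> nat \<Rightarrow> int"
  assumes "\<And>j. j < k \<Longrightarrow> 0 < v j j"
  shows "finite {y \<in> {..<k} \<rightarrow>\<^sub>E {0..<1::real}. \<forall>j<k. (\<Sum>i\<le>j. y i * of_int (v j i)) \<in> \<int>}
    \<and> int (card {y \<in> {..<k} \<rightarrow>\<^sub>E {0..<1::real}. \<forall>j<k. (\<Sum>i\<le>j. y i * of_int (v j i)) \<in> \<int>})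
      = (\<Prod>j<k. v j j)"
  using assms
proof (induction k)
  case 0
  have "{y \<in> {..<0::nat} \<rightarrow>\<^sub>E {0..<1::real}. \<forall>j<0::nat. (\<Sum>i\<le>j. y i * of_int (v j i)) \<in> \<int>}
    = {\<lambda>_. undefined}"
    by auto
  then show ?case by simp
next
  case (Suc k)
  let ?W = "\<lambda>k. {y \<in> {..<k} \<rightarrow>\<^sub>E {0..<1::real}. \<forall>j<k. (\<Sum>i\<le>j. y i * of_int (v j i)) \<in> \<int>}"
  let ?F = "\<lambda>y. {s \<in> {0..<1::real}. of_int (v k k) * s + (\<Sum>i<k. y i * of_int (v k i)) \<in> \<int>}"
  let ?f = "\<lambda>(y, s). y(k := s)"
  have IH: "finite (?W k)" "int (card (?W k)) = (\<Prod>j<k. v j j)" using Suc by auto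
  have d: "0 < v k k" using Suc.prems by simp
  have cF: "card (?F y) = nat (v k k)" for y :: "nat \<Rightarrow> real"
    by (rule card_affine_integral_residues[OF d])
  have fF: "finite (?F y)" for y :: "nat \<Rightarrow> real"
    using cF[of y] d by (intro card_ge_0_finite) simp
  have low: "(\<Sum>i\<le>j. (y(k := s)) i * real_of_int (v j i)) = (\<Sum>i\<le>j. y i * of_int (v j i))"
    if "j < k" for j y s
    by (rule sum.cong) (use that in auto)
  have top: "(\<Sum>i\<le>k. (y(k := s)) i * real_of_int (v k i))
      = of_int (v k k) * s + (\<Sum>i<k. y i * of_int (v k i))" for y s
  proof -
    have "(\<Sum>i<k. (y(k := s)) i * real_of_int (v k i)) = (\<Sum>i<k. y i * of_int (v k i))"
      by (rule sum.cong) auto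
    then show ?thesis by (simp add: lessThan_Suc flip: lessThan_Suc_atMost)
  qed
  have bij: "bij_betw ?f (SIGMA y:?W k. ?F y) (?W (Suc k))"
  proof (rule bij_betwI[where g = "\<lambda>y. (restrict y {..<k}, y k)"])
    show "?f \<in> (SIGMA y:?W k. ?F y) \<rightarrow> ?W (Suc k)"
    proof (rule funcsetI)
      fix p assume "p \<in> (SIGMA y:?W k. ?F y)"
      then obtain y s where p: "p = (y, s)" and y: "y \<in> ?W k" and s: "s \<in> ?F y" by auto
      have "y(k := s) \<in> {..<Suc k} \<rightarrow>\<^sub>E {0..<1}"
        using y s by (auto simp: PiE_iff extensional_def less_Suc_eq)
      moreover have "(\<Sum>i\<le>j. (y(k := s)) i * real_of_int (v j i)) \<in> \<int>" if "j < Suc k" for j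
        using that y s low[of j y s] top[of y s] by (cases "j = k") auto
      ultimately show "?f p \<in> ?W (Suc k)" unfolding p by simp
    qed
    show "(\<lambda>y. (restrict y {..<k}, y k)) \<in> ?W (Suc k) \<rightarrow> (SIGMA y:?W k. ?F y)"
    proof (rule funcsetI)
      fix y assume y: "y \<in> ?W (Suc k)"
      let ?y = "restrict y {..<k}"
      have yy: "?y(k := y k) = y"
        using y by (auto simp: fun_eq_iff PiE_iff extensional_def less_Suc_eq)
      have "(\<Sum>i\<le>j. ?y i * real_of_int (v j i)) \<in> \<int>" if "j < k" for j
        using low[OF that, of ?y "y k"] y that unfolding yy by simp
      moreover have "of_int (v k k) * y k + (\<Sum>i<k. ?y i * real_of_int (v k i)) \<in> \<int>"
      proof -
        have "(\<Sum>i\<le>k. y i * real_of_int (v k i)) \<in> \<int>" using y by blast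
        then show ?thesis using top[of ?y "y k"] unfolding yy by simp
      qed
      moreover have "?y \<in> {..<k} \<rightarrow>\<^sub>E {0..<1}" "y k \<in> {0..<1}"
        using y by (auto simp: PiE_iff)
      ultimately show "(?y, y k) \<in> (SIGMA y:?W k. ?F y)" by simp
    qed
    show "(restrict (?f p) {..<k}, ?f p k) = p" if "p \<in> (SIGMA y:?W k. ?F y)" for p
      using that by (auto simp: fun_eq_iff PiE_iff extensional_def)
    show "?f (restrict y {..<k}, y k) = y" if "y \<in> ?W (Suc k)" for y
      using that by (auto simp: fun_eq_iff PiE_iff extensional_def less_Suc_eq)
  qed
  have "finite (SIGMA y:?W k. ?F y)" using IH(1) fF by (rule finite_SigmaI)
  moreover have "int (card (SIGMA y:?W k. ?F y)) = (\<Prod>j<Suc k. v j j)"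
  proof -
    have "card (SIGMA y:?W k. ?F y) = (\<Sum>y\<in>?W k. card (?F y))"
      by (rule card_SigmaI) (use IH(1) fF in blast)+
    also have "\<dots> = card (?W k) * nat (v k k)" unfolding cF by simp
    finally show ?thesis using IH(2) d by simp
  qed
  ultimately show ?case
    unfolding bij_betw_finite[OF bij] bij_betw_same_card[OF bij] by (rule conjI)
qed

context integer_matrix
begin

definition integer_full_rank_on :: "nat set \<Rightarrow> bool" where
  "integer_full_rank_on S \<longleftrightarrow>
     (\<forall>z::nat \<Rightarrow> int. (\<forall>j\<in>S. (\<Sum>i<n. z i * a i j) = 0) \<longrightarrow> (\<forall>i<n. z i = 0))"

text \<open>
  The vectors \<open>v 0, \<dots>, v (n - 1)\<close> form a triangular basis of the lattice generated by the columns with index in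
  \<open>S\<close>: the two existential clauses say that the \<open>v j\<close> lie in this lattice and that they generate it.
\<close>

definition triangular_basis :: "nat set \<Rightarrow> (nat \<Rightarrow> nat \<Rightarrow> int) \<Rightarrow> bool" where
  "triangular_basis S v \<longleftrightarrow>
     (\<forall>j<n. 0 < v j j \<and> (\<forall>i<n. j < i \<longrightarrow> v j i = 0)) \<and>
     (\<exists>u. \<forall>j<n. \<forall>i<n. v j i = (\<Sum>s\<in>S. u j s * a i s)) \<and>
     (\<exists>w. \<forall>s\<in>S. \<forall>i<n. a i s = (\<Sum>j<n. w s j * v j i))"

lemma full_rank_on_imp_integer: "full_rank_on S \<Longrightarrow> integer_full_rank_on S"
  unfolding full_rank_on_def integer_full_rank_on_def
proof (intro allI impI)
  fix z :: "nat \<Rightarrow> int" and i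
  assume full: "\<forall>y. (\<forall>j\<in>S. row_comb y j = 0) \<longrightarrow> (\<forall>i<n. y i = 0)"
    and "\<forall>j\<in>S. (\<Sum>i<n. z i * a i j) = 0" "i < n"
  then have "\<forall>j\<in>S. row_comb (\<lambda>i. of_int (z i)) j = 0" by (simp add: row_comb_of_int)
  then have "real_of_int (z i) = 0" using full \<open>i < n\<close> by fastforce
  then show "z i = 0" by simp
qed

text \<open>
  A zero on the diagonal is excluded by the rank: otherwise the determinant of the
  matrix of the \<open>v j\<close> would vanish, and a nonzero integer vector in its kernel would be orthogonal to
  all columns in \<open>S\<close>.
\<close>

lemma triangular_basis_exists:
  assumes fin: "finite S" and full: "integer_full_rank_on S"
  obtains v where "triangular_basis S v"
proof -
  define G where "G = {x::nat \<Rightarrow> int. \<exists>c. \<forall>i<n. x i = (\<Sum>s\<in>S. c s * a i s)}"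
  have diff: "(\<lambda>i. x i - c * y i) \<in> G" if xy: "x \<in> G" "y \<in> G" for x y c
  proof -
    obtain p q where "\<forall>i<n. x i = (\<Sum>s\<in>S. p s * a i s)" "\<forall>i<n. y i = (\<Sum>s\<in>S. q s * a i s)"
      using xy unfolding G_def by auto
    then have "\<forall>i<n. x i - c * y i = (\<Sum>s\<in>S. (p s - c * q s) * a i s)"
      by (simp add: sum_subtractf sum_distrib_left algebra_simps)
    then show ?thesis unfolding G_def mem_Collect_eq by (rule exI[of _ "\<lambda>s. p s - c * q s"])
  qed
  have zero: "(\<lambda>_. 0) \<in> G" unfolding G_def by (auto intro!: exI[of _ "\<lambda>_. 0"])
  have cols: "(\<lambda>i. a i s) \<in> G" if "s \<in> S" for s
    unfolding G_def mem_Collect_eq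
  proof (intro exI[of _ "\<lambda>s'. if s' = s then 1 else 0"] allI impI)
    fix i
    have "(\<Sum>s'\<in>S. (if s' = s then 1 else 0) * a i s') = (\<Sum>s'\<in>S. if s' = s then a i s' else 0)"
      by (rule sum.cong) auto
    then show "a i s = (\<Sum>s'\<in>S. (if s' = s then 1 else 0) * a i s')" using that fin by simp
  qed
  define P where "P j v \<longleftrightarrow> v \<in> G \<and> (\<forall>i. j < i \<longrightarrow> i < n \<longrightarrow> v i = 0) \<and> 0 \<le> v j \<and>
      (\<forall>x\<in>G. (\<forall>i. j < i \<longrightarrow> i < n \<longrightarrow> x i = 0) \<longrightarrow> v j dvd x j)" for j v
  have "\<forall>j. \<exists>v. P j v"
  proof
    fix j
    show "\<exists>v. P j v"
    proof (rule bexE[OF triangular_generators[OF diff zero, of j n]])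
      fix v assume "v \<in> G" and "(\<forall>i. j < i \<longrightarrow> i < n \<longrightarrow> v i = 0) \<and> 0 \<le> v j \<and>
        (\<forall>x\<in>G. (\<forall>i. j < i \<longrightarrow> i < n \<longrightarrow> x i = 0) \<longrightarrow> v j dvd x j)"
      then have "P j v" unfolding P_def by (rule conjI)
      then show ?thesis by (rule exI[of _ v])
    qed
  qed
  from choice[OF this] obtain v where "\<forall>j. P j (v j)" by (elim exE)
  then have P: "P j (v j)" for j by (rule spec)
  note P' = P[unfolded P_def]
  have vG: "v j \<in> G" for j using P'[of j] by (rule conjunct1)
  have tri: "v j i = 0" if "j < i" "i < n" for i j
    using conjunct1[OF conjunct2[OF P'[of j]]] that by simp
  have pos: "0 \<le> v j j" for j
    using conjunct1[OF conjunct2[OF conjunct2[OF P'[of j]]]] .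
  have dvd: "v j j dvd x j" if "x \<in> G" "\<And>i. j < i \<Longrightarrow> i < n \<Longrightarrow> x i = 0" for j x
    using conjunct2[OF conjunct2[OF conjunct2[OF P'[of j]]]] that by simp
  have "\<exists>c. \<forall>i<n. a i s = (\<Sum>j<n. c j * v j i)" if "s \<in> S" for s
  proof (rule triangular_reduction[of G n v])
    show "(\<lambda>i. x i - c * y i) \<in> G" if "x \<in> G" "y \<in> G" for x y c using that by (rule diff)
    show "v j j dvd x j" if "x \<in> G" "\<And>i. j < i \<Longrightarrow> i < n \<Longrightarrow> x i = 0" for j x
      using that by (rule dvd)
  qed (use vG tri cols[OF that] in auto)
  then have "\<forall>s\<in>S. \<exists>c. \<forall>i<n. a i s = (\<Sum>j<n. c j * v j i)" by (rule ballI)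
  from bchoice[OF this] obtain w
    where "\<forall>s\<in>S. \<forall>i<n. a i s = (\<Sum>j<n. w s j * v j i)" by (elim exE)
  then have w: "a i s = (\<Sum>j<n. w s j * v j i)" if "s \<in> S" "i < n" for s i
    using that by simp
  have "\<forall>j. \<exists>c. \<forall>i<n. v j i = (\<Sum>s\<in>S. c s * a i s)"
  proof
    fix j
    show "\<exists>c. \<forall>i<n. v j i = (\<Sum>s\<in>S. c s * a i s)"
      using vG[of j] by (simp only: G_def mem_Collect_eq)
  qed
  from choice[OF this] obtain u where "\<forall>j. \<forall>i<n. v j i = (\<Sum>s\<in>S. u j s * a i s)" by (elim exE)
  then have u: "v j i = (\<Sum>s\<in>S. u j s * a i s)" if "i < n" for j i
    using that by simp
  let ?H = "mat n n (\<lambda>(j, i). v j i)"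
  have H: "?H \<in> carrier_mat n n" by simp
  have "det ?H \<noteq> 0"
  proof
    assume "det ?H = 0"
    then obtain z where z: "z \<in> carrier_vec n" "z \<noteq> 0\<^sub>v n" "?H *\<^sub>v z = 0\<^sub>v n"
      using det_0_iff_vec_prod_zero[OF H] by blast
    have vz: "(\<Sum>i<n. v j i * z $ i) = 0" if "j < n" for j
    proof -
      have "(?H *\<^sub>v z) $ j = (\<Sum>i<n. v j i * z $ i)"
        using that z(1) by (simp add: scalar_prod_def atLeast0LessThan)
      then show ?thesis using z(3) that by simp
    qed
    have "(\<Sum>i<n. z $ i * a i s) = 0" if "s \<in> S" for s
    proof -
      have "(\<Sum>i<n. z $ i * a i s) = (\<Sum>i<n. \<Sum>j<n. w s j * (v j i * z $ i))"
        by (rule sum.cong) (simp_all add: w[OF that] sum_distrib_left algebra_simps)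
      also have "\<dots> = (\<Sum>j<n. \<Sum>i<n. w s j * (v j i * z $ i))" by (rule sum.swap)
      also have "\<dots> = (\<Sum>j<n. w s j * (\<Sum>i<n. v j i * z $ i))"
        by (simp only: sum_distrib_left)
      also have "\<dots> = 0" by (simp add: vz)
      finally show ?thesis .
    qed
    then have "\<forall>i<n. z $ i = 0"
      by (intro full[unfolded integer_full_rank_on_def, THEN spec, of "\<lambda>i. z $ i", THEN mp] ballI)
    then have "z = 0\<^sub>v n" using z(1) by auto
    then show False using z(2) by contradiction
  qed
  moreover have "det ?H = (\<Prod>j<n. v j j)"
    by (subst det_lower_triangular[OF _ H]) (auto simp: tri prod_list_diag_prod atLeast0LessThan)
  ultimately have "v j j \<noteq> 0" if "j < n" for j using that by auto
  then have "0 < v j j" if "j < n" for j using pos[of j] that by (simp add: order_less_le)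
  then have "\<forall>j<n. 0 < v j j \<and> (\<forall>i<n. j < i \<longrightarrow> v j i = 0)" using tri by blast
  moreover have "\<exists>u. \<forall>j<n. \<forall>i<n. v j i = (\<Sum>s\<in>S. u j s * a i s)"
    by (intro exI[of _ u] allI impI) (rule u)
  moreover have "\<exists>w. \<forall>s\<in>S. \<forall>i<n. a i s = (\<Sum>j<n. w s j * v j i)"
    by (intro exI[of _ w] allI impI ballI) (rule w)
  ultimately have "triangular_basis S v" unfolding triangular_basis_def by (intro conjI)
  then show thesis by (rule that)
qed

lemma triangular_basisE:
  assumes "triangular_basis S v"
  obtains u w where "\<And>j. j < n \<Longrightarrow> 0 < v j j"
    and "\<And>i j. j < i \<Longrightarrow> i < n \<Longrightarrow> v j i = 0"
    and "\<And>j i. j < n \<Longrightarrow> i < n \<Longrightarrow> v j i = (\<Sum>s\<in>S. u j s * a i s)"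
    and "\<And>s i. s \<in> S \<Longrightarrow> i < n \<Longrightarrow> a i s = (\<Sum>j<n. w s j * v j i)"
proof -
  obtain u w where 1: "\<forall>j<n. 0 < v j j \<and> (\<forall>i<n. j < i \<longrightarrow> v j i = 0)"
    and u: "\<forall>j<n. \<forall>i<n. v j i = (\<Sum>s\<in>S. u j s * a i s)"
    and w: "\<forall>s\<in>S. \<forall>i<n. a i s = (\<Sum>j<n. w s j * v j i)"
    using assms unfolding triangular_basis_def by (elim conjE exE)
  show thesis
  proof (rule that[of u w])
    show "v j i = 0" if "j < i" "i < n" for i j using 1 that less_trans[OF that] by blast
    show "v j i = (\<Sum>s\<in>S. u j s * a i s)" if "j < n" "i < n" for j i using u that by blast
    show "a i s = (\<Sum>j<n. w s j * v j i)" if "s \<in> S" "i < n" for s i using w that by blast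
  qed (use 1 in blast)
qed

lemma triangular_basis_pos:
  assumes "triangular_basis S v" "j < n"
  shows "0 < v j j"
  using conjunct1[OF assms(1)[unfolded triangular_basis_def]] assms(2) by simp

text \<open>
  The combination \<open>y\<close> of the rows evaluates, at the columns and at the basis vectors \<open>v j\<close>, to values that are integer combinations of each
  other. The cases \<open>\<int>\<close> and \<open>{0}\<close> serve the counting of torsion points and the
  independence of the rows.
\<close>

lemma integral_on_iff_triangular:
  assumes v: "triangular_basis S v" and Z: "Z = \<int> \<or> Z = {0}"
  shows "(\<forall>s\<in>S. row_comb y s \<in> Z) \<longleftrightarrow> (\<forall>j<n. (\<Sum>i\<le>j. y i * of_int (v j i)) \<in> Z)"
proof (rule triangular_basisE[OF v])
  fix u w
  assume tri: "\<And>i j. j < i \<Longrightarrow> i < n \<Longrightarrow> v j i = 0"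
    and u: "\<And>j i. j < n \<Longrightarrow> i < n \<Longrightarrow> v j i = (\<Sum>s\<in>S. u j s * a i s)"
    and w: "\<And>s i. s \<in> S \<Longrightarrow> i < n \<Longrightarrow> a i s = (\<Sum>j<n. w s j * v j i)"
  have comb: "(\<Sum>i\<in>I. of_int (c i) * f i) \<in> Z" if "\<And>i. i \<in> I \<Longrightarrow> f i \<in> Z"
    for I :: "nat set" and c :: "nat \<Rightarrow> int" and f
    using Z
  proof
    assume "Z = \<int>"
    then show ?thesis using that by (auto intro!: Ints_sum Ints_mult)
  next
    assume "Z = {0}"
    then show ?thesis using that by (auto intro!: sum.neutral)
  qed
  have tr: "(\<Sum>i\<le>j. y i * real_of_int (v j i)) = (\<Sum>i<n. y i * of_int (v j i))" if "j < n" for j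
    by (rule sum.mono_neutral_left) (use that tri in auto)
  have 1: "row_comb y s = (\<Sum>j<n. of_int (w s j) * (\<Sum>i\<le>j. y i * of_int (v j i)))"
    if "s \<in> S" for s
  proof -
    have "row_comb y s = (\<Sum>i<n. \<Sum>j<n. of_int (w s j) * (y i * of_int (v j i)))"
      unfolding row_comb_def
      by (rule sum.cong) (simp_all add: w[OF that] sum_distrib_left algebra_simps)
    also have "\<dots> = (\<Sum>j<n. \<Sum>i<n. of_int (w s j) * (y i * of_int (v j i)))" by (rule sum.swap)
    also have "\<dots> = (\<Sum>j<n. of_int (w s j) * (\<Sum>i\<le>j. y i * of_int (v j i)))"
      by (rule sum.cong) (simp_all add: tr sum_distrib_left)
    finally show ?thesis .
  qed
  have 2: "(\<Sum>i\<le>j. y i * of_int (v j i)) = (\<Sum>s\<in>S. of_int (u j s) * row_comb y s)"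
    if "j < n" for j
  proof -
    have "(\<Sum>i<n. y i * of_int (v j i)) = (\<Sum>i<n. \<Sum>s\<in>S. of_int (u j s) * (y i * of_int (a i s)))"
      by (rule sum.cong) (simp_all add: u[OF that] sum_distrib_left algebra_simps)
    also have "\<dots> = (\<Sum>s\<in>S. \<Sum>i<n. of_int (u j s) * (y i * of_int (a i s)))" by (rule sum.swap)
    finally show ?thesis using tr[OF that] by (simp add: row_comb_def sum_distrib_left)
  qed
  show ?thesis
  proof (intro iffI ballI allI impI)
    fix j assume "\<forall>s\<in>S. row_comb y s \<in> Z" and j: "j < n"
    then show "(\<Sum>i\<le>j. y i * of_int (v j i)) \<in> Z"
      unfolding 2[OF j] by (intro comb) blast
  next
    fix s assume "\<forall>j<n. (\<Sum>i\<le>j. y i * of_int (v j i)) \<in> Z" and s: "s \<in> S"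
    then show "row_comb y s \<in> Z"
      unfolding 1[OF s] by (intro comb) blast
  qed
qed

lemma card_torsion_points:
  assumes "triangular_basis S v"
  shows "finite (torsion_points S)" "int (card (torsion_points S)) = (\<Prod>j<n. v j j)"
proof -
  have "torsion_points S
    = {y \<in> {..<n} \<rightarrow>\<^sub>E {0..<1::real}. \<forall>j<n. (\<Sum>i\<le>j. y i * of_int (v j i)) \<in> \<int>}"
    unfolding torsion_points_def integral_on_iff_triangular[OF assms disjI1[OF refl]] ..
  moreover note triangular_basis_pos[OF assms]
  ultimately show "finite (torsion_points S)" "int (card (torsion_points S)) = (\<Prod>j<n. v j j)"
    using card_triangular_integral_points[of n v] by presburger+
qed

lemma triangular_basis_imp_full_rank:
  assumes v: "triangular_basis S v"
  shows "full_rank_on S"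
  unfolding full_rank_on_def
proof (intro allI impI)
  fix y i assume y: "\<forall>j\<in>S. row_comb y j = 0" and i: "i < n"
  have 0: "(\<Sum>i\<le>j. y i * of_int (v j i)) = 0" if "j < n" for j
    using integral_on_iff_triangular[OF v disjI2[OF refl], of y] y that by simp
  show "y i = 0" using i
  proof (induction i rule: less_induct)
    case (less i)
    have "(\<Sum>l<i. y l * real_of_int (v i l)) = 0"
      by (rule sum.neutral) (use less in auto)
    then have "y i * real_of_int (v i i) = 0"
      using 0[OF less.prems] by (simp add: lessThan_Suc flip: lessThan_Suc_atMost)
    moreover have "v i i \<noteq> 0" using triangular_basis_pos[OF v less.prems] by simp
    ultimately show ?case by simp
  qed
qed

end

lemma triangular_system_solvable:
  fixes v :: "nat \<Rightarrow> nat \<Rightarrow> int" and r :: "nat \<Rightarrow> real"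
  assumes "\<And>j. j < k \<Longrightarrow> 0 < v j j"
  shows "\<exists>y. \<forall>j<k. (\<Sum>i\<le>j. y i * of_int (v j i)) = r j"
  using assms
proof (induction k)
  case 0
  then show ?case by simp
next
  case (Suc k)
  then obtain y where y: "\<And>j. j < k \<Longrightarrow> (\<Sum>i\<le>j. y i * of_int (v j i)) = r j" by auto
  define s where "s = (r k - (\<Sum>i<k. y i * of_int (v k i))) / of_int (v k k)"
  have "(\<Sum>i\<le>j. (y(k := s)) i * real_of_int (v j i)) = r j" if "j < Suc k" for j
  proof (cases "j = k")
    case False
    then have "(\<Sum>i\<le>j. (y(k := s)) i * real_of_int (v j i)) = (\<Sum>i\<le>j. y i * of_int (v j i))"
      using that by (intro sum.cong) auto
    then show ?thesis using y[of j] that False by simp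
  next
    case True
    have "v k k > 0" using Suc.prems by simp
    have "(\<Sum>i<k. (y(k := s)) i * real_of_int (v k i)) = (\<Sum>i<k. y i * of_int (v k i))"
      by (rule sum.cong) auto
    then have "(\<Sum>i\<le>k. (y(k := s)) i * real_of_int (v k i)) = r k"
      using \<open>v k k > 0\<close> by (simp add: s_def lessThan_Suc flip: lessThan_Suc_atMost)
    then show ?thesis using True by simp
  qed
  then show ?case by (intro exI[of _ "y(k := s)"]) simp
qed

context integer_matrix
begin

text \<open>
  If the index is \<open>1\<close>, then all diagonal entries are units, and elimination expresses every integer vector.
\<close>

lemma columns_generate_if_saturated:
  assumes v: "triangular_basis S v" and sat: "card (torsion_points S) = 1"
  shows "\<exists>c. \<forall>i<n. x i = (\<Sum>s\<in>S. c s * a i s)"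
proof (rule triangular_basisE[OF v])
  fix u
  assume tri: "\<And>i j. j < i \<Longrightarrow> i < n \<Longrightarrow> v j i = 0"
    and u: "\<And>j i. j < n \<Longrightarrow> i < n \<Longrightarrow> v j i = (\<Sum>s\<in>S. u j s * a i s)"
  have unit: "v j j dvd 1" if "j < n" for j
  proof -
    have "v j j dvd (\<Prod>j<n. v j j)" using that by (intro dvd_prodI) auto
    then show ?thesis using card_torsion_points(2)[OF v] sat by simp
  qed
  have "\<exists>c. \<forall>i<n. x i = (\<Sum>j<n. c j * v j i)"
  proof (rule triangular_reduction[of UNIV n v])
    show "v j j dvd z j" if "j < n" for j and z :: "nat \<Rightarrow> int"
      using unit[OF that] one_dvd by (rule dvd_trans)
  qed (simp_all add: tri)
  then obtain c where c: "\<And>i. i < n \<Longrightarrow> x i = (\<Sum>j<n. c j * v j i)" by blast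
  have "x i = (\<Sum>s\<in>S. (\<Sum>j<n. c j * u j s) * a i s)" if "i < n" for i
  proof -
    have "x i = (\<Sum>j<n. \<Sum>s\<in>S. c j * u j s * a i s)"
      unfolding c[OF that]
      by (rule sum.cong) (simp_all add: u that sum_distrib_left mult.assoc)
    also have "\<dots> = (\<Sum>s\<in>S. \<Sum>j<n. c j * u j s * a i s)" by (rule sum.swap)
    finally show ?thesis by (simp only: sum_distrib_right)
  qed
  then show ?thesis by (intro exI[of _ "\<lambda>s. \<Sum>j<n. c j * u j s"]) simp
qed

text \<open>
  The real row space is the orthogonal complement of the integer kernel. Writing the column \<open>s\<close> in
  terms of the basis \<open>v\<close>, and \<open>v\<close> again in terms of the columns, produces for each \<open>s\<close> an integer kernel vector
  \<open>e\<^sub>s - \<Sum>\<^sub>j w s j u j\<close>. Orthogonality to it shows that \<open>x\<close> is determined by its products \<open>r j\<close> with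
  the vectors \<open>u j\<close>, and a triangular system yields the \<open>y\<close> whose products with the \<open>v j\<close> are these numbers.
\<close>

lemma orthogonal_to_integer_kernel_imp_row_comb:
  fixes x :: "nat \<Rightarrow> real"
  assumes v: "triangular_basis S v" and fin: "finite S"
    and orth: "\<And>z::nat \<Rightarrow> int. (\<And>i. i < n \<Longrightarrow> (\<Sum>s\<in>S. z s * a i s) = 0) \<Longrightarrow>
      (\<Sum>s\<in>S. of_int (z s) * x s) = 0"
  shows "\<exists>y. \<forall>s\<in>S. x s = row_comb y s"
proof (rule triangular_basisE[OF v])
  fix u w
  assume pos: "\<And>j. j < n \<Longrightarrow> 0 < v j j"
    and tri: "\<And>i j. j < i \<Longrightarrow> i < n \<Longrightarrow> v j i = 0"
    and u: "\<And>j i. j < n \<Longrightarrow> i < n \<Longrightarrow> v j i = (\<Sum>s\<in>S. u j s * a i s)"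
    and w: "\<And>s i. s \<in> S \<Longrightarrow> i < n \<Longrightarrow> a i s = (\<Sum>j<n. w s j * v j i)"
  define r where "r j = (\<Sum>s\<in>S. of_int (u j s) * x s)" for j
  obtain y where y: "\<And>j. j < n \<Longrightarrow> (\<Sum>i\<le>j. y i * of_int (v j i)) = r j"
    using triangular_system_solvable[of n v r] pos by blast
  have y': "(\<Sum>i<n. y i * real_of_int (v j i)) = r j" if "j < n" for j
  proof -
    have "(\<Sum>i\<le>j. y i * real_of_int (v j i)) = (\<Sum>i<n. y i * of_int (v j i))"
      by (rule sum.mono_neutral_left) (use that tri in auto)
    then show ?thesis using y[OF that] by simp
  qed
  have "x s = row_comb y s" if s: "s \<in> S" for s
  proof -
    \<comment> \<open>the kernel vector \<open>e\<^sub>s - \<Sum>\<^sub>j w s j u j\<close>\<close>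
    define z where "z s' = (if s' = s then 1 else 0) - (\<Sum>j<n. w s j * u j s')" for s'
    have z0: "(\<Sum>s'\<in>S. z s' * a i s') = 0" if i: "i < n" for i
    proof -
      have "(\<Sum>s'\<in>S. z s' * a i s')
          = (\<Sum>s'\<in>S. (if s' = s then a i s' else 0)) - (\<Sum>s'\<in>S. \<Sum>j<n. w s j * u j s' * a i s')"
        unfolding sum_subtractf[symmetric]
        by (rule sum.cong) (simp_all add: z_def left_diff_distrib sum_distrib_right)
      also have "(\<Sum>s'\<in>S. \<Sum>j<n. w s j * u j s' * a i s') = (\<Sum>j<n. \<Sum>s'\<in>S. w s j * u j s' * a i s')"
        by (rule sum.swap)
      also have "\<dots> = (\<Sum>j<n. w s j * v j i)"
        by (rule sum.cong) (simp_all add: u i sum_distrib_left mult.assoc)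
      also have "\<dots> = a i s" using w[OF s i] by (rule sym)
      finally show ?thesis using s fin by simp
    qed
    have "(\<Sum>s'\<in>S. of_int (z s') * x s')
        = (\<Sum>s'\<in>S. (if s' = s then x s' else 0)) - (\<Sum>s'\<in>S. \<Sum>j<n. of_int (w s j) * (of_int (u j s') * x s'))"
      unfolding sum_subtractf[symmetric]
      by (rule sum.cong) (simp_all add: z_def left_diff_distrib sum_distrib_right mult.assoc)
    also have "(\<Sum>s'\<in>S. \<Sum>j<n. of_int (w s j) * (of_int (u j s') * x s'))
        = (\<Sum>j<n. \<Sum>s'\<in>S. of_int (w s j) * (of_int (u j s') * x s'))"
      by (rule sum.swap)
    also have "\<dots> = (\<Sum>j<n. of_int (w s j) * r j)"
      by (simp only: r_def sum_distrib_left)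
    finally have "x s = (\<Sum>j<n. of_int (w s j) * r j)"
      using orth[of z, OF z0] s fin by simp
    also have "\<dots> = (\<Sum>j<n. \<Sum>i<n. of_int (w s j) * (y i * of_int (v j i)))"
      by (rule sum.cong) (simp_all add: sum_distrib_left flip: y')
    also have "\<dots> = (\<Sum>i<n. \<Sum>j<n. of_int (w s j) * (y i * of_int (v j i)))" by (rule sum.swap)
    also have "\<dots> = row_comb y s"
      unfolding row_comb_def
      by (rule sum.cong) (simp_all add: w[OF s] sum_distrib_left mult_ac)
    finally show ?thesis .
  qed
  then show ?thesis by (intro exI[of _ y] ballI)
qed

end

section \<open>The index of the row lattice and the maximal minors\<close>

lemma bij_betw_pick:
  assumes "finite S"
  shows "bij_betw (pick S) {..<card S} S"
proof -
  have "pick S i < pick S j" if "i < j" "j < card S" for i j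
    using that by (rule pick_mono_le[rotated])
  then have inj: "inj_on (pick S) {..<card S}"
    by (intro inj_onI) (metis lessThan_iff linorder_neqE_nat order_less_irrefl)
  moreover have "pick S ` {..<card S} = S"
  proof (rule card_subset_eq[OF assms])
    show "pick S ` {..<card S} \<subseteq> S" using pick_in_set_le by auto
    show "card (pick S ` {..<card S}) = card S" using inj by (simp add: card_image)
  qed
  ultimately show ?thesis by (simp add: bij_betw_def)
qed

lemma pick_lessThan:
  assumes "i < n"
  shows "pick {..<n} i = i"
proof -
  have "{b \<in> {..<n}. b < i} = {..<i}" using assms by auto
  then show ?thesis using pick_card_in_set[of i "{..<n}"] assms by simp
qed

context integer_matrix
begin

text \<open>
  The columns may be listed in any order and with repetitions, which is the form in which minors
  arise from multilinear expansion. They are the rows of the matrix here, because the expansion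
  is by rows.
\<close>

definition minor :: "(nat \<Rightarrow> nat) \<Rightarrow> int" where
  "minor f = det (mat n n (\<lambda>(k, i). a i (f k)))"

lemma det_triangular:
  assumes "triangular_basis S v"
  shows "det (mat n n (\<lambda>(j, i). v j i)) = (\<Prod>j<n. v j j)"
proof (rule triangular_basisE[OF assms])
  assume tri: "\<And>i j. j < i \<Longrightarrow> i < n \<Longrightarrow> v j i = 0"
  show ?thesis
    by (subst det_lower_triangular[of n]) (auto simp: tri prod_list_diag_prod atLeast0LessThan)
qed

text \<open>
  The columns are integer combinations of the basis, so the matrix of the minor factors through
  that of the basis.
\<close>

lemma diagonal_dvd_minor:
  assumes v: "triangular_basis S v" and f: "f ` {..<n} \<subseteq> S"
  shows "(\<Prod>j<n. v j j) dvd minor f"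
proof (rule triangular_basisE[OF v])
  fix w assume w: "\<And>s i. s \<in> S \<Longrightarrow> i < n \<Longrightarrow> a i s = (\<Sum>j<n. w s j * v j i)"
  let ?W = "mat n n (\<lambda>(k, j). w (f k) j)" and ?H = "mat n n (\<lambda>(j, i). v j i)"
  have "mat n n (\<lambda>(k, i). a i (f k)) = ?W * ?H"
  proof (rule eq_matI)
    fix k i assume "k < dim_row (?W * ?H)" "i < dim_col (?W * ?H)"
    then have ki: "k < n" "i < n" by auto
    then have "f k \<in> S" using f by auto
    then show "mat n n (\<lambda>(k, i). a i (f k)) $$ (k, i) = (?W * ?H) $$ (k, i)"
      using ki w[of "f k" i] by (simp add: scalar_prod_def atLeast0LessThan)
  qed auto
  then have "minor f = det ?W * det ?H"
    unfolding minor_def by (simp add: det_mult[of _ n])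
  then show ?thesis unfolding det_triangular[OF v] by simp
qed

text \<open>
  Each basis vector is an integer combination of columns. Expanding the determinant of the basis by
  multilinearity yields minors, and those with a repeated column vanish.
\<close>

lemma dvd_diagonal:
  assumes v: "triangular_basis S v" and fin: "finite S"
    and dvd: "\<And>f. inj_on f {..<n} \<Longrightarrow> f ` {..<n} \<subseteq> S \<Longrightarrow> g dvd minor f"
  shows "g dvd (\<Prod>j<n. v j j)"
proof (rule triangular_basisE[OF v])
  fix u assume u: "\<And>j i. j < n \<Longrightarrow> i < n \<Longrightarrow> v j i = (\<Sum>s\<in>S. u j s * a i s)"
  let ?c = "\<lambda>s. vec n (\<lambda>i. a i s)"
  let ?F = "{f. (\<forall>i\<in>{0..<n}. f i \<in> S) \<and> (\<forall>i. i \<notin> {0..<n} \<longrightarrow> f i = i)}"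
  have H: "mat n n (\<lambda>(j, i). v j i)
      = mat\<^sub>r n n (\<lambda>j. finsum_vec TYPE(int) n (\<lambda>s. u j s \<cdot>\<^sub>v ?c s) S)"
  proof (rule eq_matI)
    fix j i
    let ?R = "mat\<^sub>r n n (\<lambda>j. finsum_vec TYPE(int) n (\<lambda>s. u j s \<cdot>\<^sub>v ?c s) S)"
    assume "j < dim_row ?R" "i < dim_col ?R"
    then have ji: "j < n" "i < n" by auto
    have "finsum_vec TYPE(int) n (\<lambda>s. u j s \<cdot>\<^sub>v ?c s) S $ i = (\<Sum>s\<in>S. (u j s \<cdot>\<^sub>v ?c s) $ i)"
      by (rule index_finsum_vec[OF fin ji(2)]) auto
    also have "\<dots> = v j i" using ji u[of j i] by simp
    finally show "mat n n (\<lambda>(j, i). v j i) $$ (j, i) = ?R $$ (j, i)"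
      using ji by simp
  qed auto
  have "(\<Prod>j<n. v j j) = (\<Sum>f\<in>?F. det (mat\<^sub>r n n (\<lambda>j. u j (f j) \<cdot>\<^sub>v ?c (f j))))"
    unfolding det_triangular[OF v, symmetric] H
    by (rule det_linear_rows_sum[OF fin]) auto
  also have "g dvd \<dots>"
  proof (rule dvd_sum)
    fix f assume f: "f \<in> ?F"
    have rm: "mat\<^sub>r n n (\<lambda>j. ?c (f j)) = mat n n (\<lambda>(k, i). a i (f k))"
      by (rule eq_matI) auto
    have "det (mat\<^sub>r n n (\<lambda>j. u j (f j) \<cdot>\<^sub>v ?c (f j)))
        = prod (\<lambda>j. u j (f j)) {0..<n} * det (mat\<^sub>r n n (\<lambda>j. ?c (f j)))"
      by (rule det_rows_mul) auto
    also have "\<dots> = prod (\<lambda>j. u j (f j)) {0..<n} * minor f"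
      unfolding rm minor_def ..
    also have "g dvd \<dots>"
    proof (cases "inj_on f {..<n}")
      case True
      then have "g dvd minor f" using f by (intro dvd) auto
      then show ?thesis by simp
    next
      case False
      then obtain k l where kl: "k < n" "l < n" "k \<noteq> l" "f k = f l" by (auto simp: inj_on_def)
      have "minor f = 0"
        unfolding minor_def
        by (rule det_identical_rows[of _ n k l]) (use kl in \<open>auto simp: row_def\<close>)
      then show ?thesis by simp
    qed
    finally show "g dvd det (mat\<^sub>r n n (\<lambda>j. u j (f j) \<cdot>\<^sub>v ?c (f j)))" .
  qed
  finally show ?thesis .
qed

lemma minor_reorder:
  assumes f: "inj_on f {..<n}" and h: "inj_on h {..<n}" and img: "f ` {..<n} = h ` {..<n}"
  shows "minor h dvd minor f"
proof -
  define p where "p k = (if k < n then inv_into {..<n} h (f k) else k)" for k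
  have hp: "h (p k) = f k" "p k < n" if "k < n" for k
  proof -
    have "f k \<in> h ` {..<n}" using img that by blast
    then show "h (p k) = f k" "p k < n"
      using that f_inv_into_f[of "f k" h "{..<n}"] inv_into_into[of "f k" h "{..<n}"]
      by (auto simp: p_def)
  qed
  have "inj_on p {0..<n}"
  proof (rule inj_onI)
    fix k l assume "k \<in> {0..<n}" "l \<in> {0..<n}" "p k = p l"
    then show "k = l" using hp(1)[of k] hp(1)[of l] inj_onD[OF f, of k l] by simp
  qed
  moreover have "p ` {0..<n} \<subseteq> {0..<n}" using hp(2) by auto
  ultimately have "bij_betw p {0..<n} {0..<n}"
    by (simp add: bij_betw_def endo_inj_surj)
  then have p: "p permutes {0..<n}"
    by (rule bij_imp_permutes) (simp add: p_def)
  let ?M = "mat n n (\<lambda>(k, i). a i (h k))"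
  have "mat n n (\<lambda>(k, i). ?M $$ (p k, i)) = mat n n (\<lambda>(k, i). a i (f k))"
    by (rule eq_matI) (auto simp: hp)
  then have "minor f = signof p * minor h"
    using det_permute_rows[of ?M n p] p unfolding minor_def by simp
  then show ?thesis by simp
qed

end

lemma det_columns_submatrix:
  fixes A :: "int mat"
  assumes A: "A \<in> carrier_mat n m" and S: "S \<subseteq> {..<m}"
    and J: "J \<subseteq> {..<card S}" "card J = n"
  shows "det (submatrix (columns_submatrix A S) {..<n} J)
    = integer_matrix.minor n (\<lambda>i j. A $$ (i, j)) (\<lambda>k. pick S (pick J k))"
proof -
  let ?B = "columns_submatrix A S"
  have sets: "{i. i < n \<and> i \<in> (UNIV :: nat set)} = {..<n}" "{j. j < m \<and> j \<in> S} = S"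
    "{i. i < n \<and> i \<in> {..<n}} = {..<n}" "{j. j < card S \<and> j \<in> J} = J"
    using S J by auto
  have dimA: "dim_row A = n" "dim_col A = m" using A by auto
  have dimB: "dim_row ?B = n" "dim_col ?B = card S"
    unfolding dim_submatrix dimA sets by simp_all
  have dimC: "dim_row (submatrix ?B {..<n} J) = n" "dim_col (submatrix ?B {..<n} J) = n"
    by (simp_all only: dim_submatrix(1)[of ?B] dim_submatrix(2)[of ?B] dimB sets card_lessThan J(2))
  have fJ: "finite J" using J finite_subset by blast
  have idx: "submatrix ?B {..<n} J $$ (i, k) = A $$ (i, pick S (pick J k))"
    if ik: "i < n" "k < n" for i k
  proof -
    have "pick J k \<in> J" using pick_in_set_le ik(2) J(2) by simp
    then have "pick J k < card S" using J(1) by auto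
    then have "?B $$ (i, pick J k) = A $$ (pick UNIV i, pick S (pick J k))"
      by (intro submatrix_index) (simp_all only: dimA sets card_lessThan ik(1))
    moreover have "submatrix ?B {..<n} J $$ (i, k) = ?B $$ (pick {..<n} i, pick J k)"
      by (rule submatrix_index) (simp_all only: dimB sets card_lessThan ik J(2))
    ultimately show ?thesis by (simp only: pick_lessThan[OF ik(1)] pick_UNIV)
  qed
  have "submatrix ?B {..<n} J
      = transpose_mat (mat n n (\<lambda>(k, i). A $$ (i, pick S (pick J k))))"
    by (rule eq_matI) (auto simp: idx dimC)
  then show ?thesis
    unfolding integer_matrix.minor_def by (simp add: det_transpose[of _ n])
qed

text \<open>
  Passing from column sets, enumerated increasingly by \<^const>\<open>pick\<close>, to arbitrary injective
  enumerations changes minors only by a sign.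
\<close>

lemma dvd_minors_gcd_iff:
  fixes A :: "int mat"
  assumes A: "A \<in> carrier_mat n m" and S: "S \<subseteq> {..<m}" and n: "n \<le> card S"
  shows "g dvd minors_gcd (columns_submatrix A S) \<longleftrightarrow>
    (\<forall>f. inj_on f {..<n} \<and> f ` {..<n} \<subseteq> S \<longrightarrow> g dvd integer_matrix.minor n (\<lambda>i j. A $$ (i, j)) f)"
proof -
  let ?B = "columns_submatrix A S"
  let ?minor = "integer_matrix.minor n (\<lambda>i j. A $$ (i, j))"
  interpret integer_matrix n "\<lambda>i j. A $$ (i, j)" .
  have finS: "finite S" using S finite_subset by blast
  have pickS: "bij_betw (pick S) {..<card S} S" using finS by (rule bij_betw_pick)
  have pick_inj: "inj_on (pick S) J" if "J \<subseteq> {..<card S}" for J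
    by (rule inj_on_subset[OF bij_betw_imp_inj_on[OF pickS] that])
  have pick_img: "pick S ` {..<card S} = S" by (rule bij_betw_imp_surj_on[OF pickS])
  have sets: "{i. i < n \<and> i \<in> (UNIV :: nat set)} = {..<n}" "{j. j < m \<and> j \<in> S} = S"
    using S by auto
  have dimA: "dim_row A = n" "dim_col A = m" using A by auto
  have dimB: "dim_row ?B = n" "dim_col ?B = card S"
    unfolding dim_submatrix dimA sets by simp_all
  have I: "I \<subseteq> {..<n} \<and> card I = n \<longleftrightarrow> I = {..<n}" for I :: "nat set"
    using card_subset_eq[of "{..<n}" I] by auto
  have "{det (submatrix ?B I J) | I J. I \<subseteq> {..<n} \<and> J \<subseteq> {..<card S} \<and> card I = n \<and> card J = n}
    = {det (submatrix ?B {..<n} J) | J. J \<subseteq> {..<card S} \<and> card J = n}"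
  proof (intro equalityI subsetI)
    fix x
    assume "x \<in> {det (submatrix ?B I J) | I J.
      I \<subseteq> {..<n} \<and> J \<subseteq> {..<card S} \<and> card I = n \<and> card J = n}"
    then obtain I' J where x: "x = det (submatrix ?B I' J)"
      and I': "I' \<subseteq> {..<n} \<and> card I' = n" and J: "J \<subseteq> {..<card S}" "card J = n" by auto
    have "I' = {..<n}" using I I' by (rule iffD1)
    then show "x \<in> {det (submatrix ?B {..<n} J) | J. J \<subseteq> {..<card S} \<and> card J = n}"
      using x J by auto
  next
    fix x assume "x \<in> {det (submatrix ?B {..<n} J) | J. J \<subseteq> {..<card S} \<and> card J = n}"
    then obtain J where "x = det (submatrix ?B {..<n} J)" "J \<subseteq> {..<card S}" "card J = n" by auto
    then show "x \<in> {det (submatrix ?B I J) | I J.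
      I \<subseteq> {..<n} \<and> J \<subseteq> {..<card S} \<and> card I = n \<and> card J = n}"
      by (intro CollectI exI[of _ "{..<n}"] exI[of _ J]) simp
  qed
  also have "\<dots> = {minor (\<lambda>k. pick S (pick J k)) | J. J \<subseteq> {..<card S} \<and> card J = n}"
    using det_columns_submatrix[OF A S] by (intro Collect_cong ex_cong1) auto
  finally have gcd: "minors_gcd ?B
      = Gcd {minor (\<lambda>k. pick S (pick J k)) | J. J \<subseteq> {..<card S} \<and> card J = n}"
    unfolding minors_gcd_def dimB using n by (simp add: min_absorb1)
  have pickJ: "inj_on (\<lambda>k. pick S (pick J k)) {..<n}"
    "(\<lambda>k. pick S (pick J k)) ` {..<n} = pick S ` J"
    if J: "J \<subseteq> {..<card S}" "card J = n" for J
  proof -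
    have "finite J" using J(1) finite_subset by blast
    then have bJ: "bij_betw (pick J) {..<n} J" using bij_betw_pick[of J] J(2) by simp
    moreover note pick_inj[OF J(1)]
    ultimately have "inj_on (pick S \<circ> pick J) {..<n}" by (auto simp: bij_betw_def intro: comp_inj_on)
    then show "inj_on (\<lambda>k. pick S (pick J k)) {..<n}" by (simp add: o_def)
    show "(\<lambda>k. pick S (pick J k)) ` {..<n} = pick S ` J"
      using bJ by (simp add: bij_betw_def flip: image_image)
  qed
  show ?thesis
  proof (intro iffI allI impI)
    fix f assume g: "g dvd minors_gcd ?B" and f: "inj_on f {..<n} \<and> f ` {..<n} \<subseteq> S"
    define J where "J = {j \<in> {..<card S}. pick S j \<in> f ` {..<n}}"
    have J1: "J \<subseteq> {..<card S}" unfolding J_def by auto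
    have img: "pick S ` J = f ` {..<n}"
    proof
      show "pick S ` J \<subseteq> f ` {..<n}" unfolding J_def by auto
      show "f ` {..<n} \<subseteq> pick S ` J"
      proof
        fix x assume x: "x \<in> f ` {..<n}"
        then have "x \<in> pick S ` {..<card S}" unfolding pick_img using f by blast
        then show "x \<in> pick S ` J" using x unfolding J_def by auto
      qed
    qed
    have "card J = card (pick S ` J)" by (rule card_image[OF pick_inj[OF J1], symmetric])
    also have "\<dots> = n" unfolding img using f by (simp add: card_image)
    finally have J: "J \<subseteq> {..<card S}" "card J = n" using J1 by auto
    have "g dvd minor (\<lambda>k. pick S (pick J k))"
      using g[unfolded gcd dvd_Gcd_iff, THEN bspec] J by blast
    moreover have "minor (\<lambda>k. pick S (pick J k)) dvd minor f"
      using pickJ[OF J] f img by (intro minor_reorder) auto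
    ultimately show "g dvd minor f" by (rule dvd_trans)
  next
    assume *: "\<forall>f. inj_on f {..<n} \<and> f ` {..<n} \<subseteq> S \<longrightarrow> g dvd minor f"
    show "g dvd minors_gcd ?B"
      unfolding gcd dvd_Gcd_iff
    proof
      fix x assume "x \<in> {minor (\<lambda>k. pick S (pick J k)) | J. J \<subseteq> {..<card S} \<and> card J = n}"
      then obtain J where x: "x = minor (\<lambda>k. pick S (pick J k))" and J: "J \<subseteq> {..<card S}" "card J = n"
        by blast
      have "pick S ` J \<subseteq> S" using image_mono[OF J(1), of "pick S"] unfolding pick_img .
      then show "g dvd x"
        unfolding x by (intro *[rule_format] conjI pickJ(1)[OF J]) (simp only: pickJ(2)[OF J])
    qed
  qed
qed

lemma columns_submatrix_all:
  fixes A :: "int mat"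
  assumes "A \<in> carrier_mat n m"
  shows "columns_submatrix A {..<m} = A"
proof -
  have dims: "dim_row A = n" "dim_col A = m" using assms by auto
  have sets: "{i. i < n \<and> i \<in> (UNIV :: nat set)} = {..<n}" "{j. j < m \<and> j \<in> {..<m}} = {..<m}"
    by auto
  show ?thesis
  proof (rule eq_matI)
    fix i j assume "i < dim_row A" "j < dim_col A"
    then have ij: "i < n" "j < m" using dims by auto
    have "columns_submatrix A {..<m} $$ (i, j) = A $$ (pick UNIV i, pick {..<m} j)"
      by (rule submatrix_index) (simp_all only: dims sets card_lessThan ij)
    then show "columns_submatrix A {..<m} $$ (i, j) = A $$ (i, j)"
      by (simp only: pick_UNIV pick_lessThan[OF ij(2)])
  qed (simp_all only: dim_submatrix dims sets card_lessThan)
qed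

text \<open>
  The index of the row lattice of \<open>A\<^sub>S\<close> in its saturation. Both numbers equal the
  product of the diagonal entries of a triangular basis of the column lattice.
\<close>

lemma card_torsion_points_eq_minors_gcd:
  fixes A :: "int mat"
  defines "a \<equiv> \<lambda>i j. A $$ (i, j)"
  assumes A: "A \<in> carrier_mat n m" and S: "S \<subseteq> {..<m}"
    and full: "integer_matrix.full_rank_on n a S"
  shows "int (card (integer_matrix.torsion_points n a S)) = minors_gcd (columns_submatrix A S)"
    and "minors_gcd (columns_submatrix A S) > 0"
proof -
  interpret integer_matrix n a .
  have finS: "finite S" using S finite_subset by blast
  obtain v where v: "triangular_basis S v"
    by (rule triangular_basis_exists[OF finS full_rank_on_imp_integer[OF full]])
  let ?d = "\<Prod>j<n. v j j"
  have pos: "?d > 0" by (rule prod_pos) (use triangular_basis_pos[OF v] in auto)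
  have "n \<le> card S"
  proof (rule ccontr)
    assume small: "\<not> n \<le> card S"
    have "\<not> (inj_on f {..<n} \<and> f ` {..<n} \<subseteq> S)" for f :: "nat \<Rightarrow> nat"
      using card_inj_on_le[of f "{..<n}" S] small finS by auto
    then have "0 dvd ?d" by (intro dvd_diagonal[OF v finS]) blast
    then have "?d = 0" by (simp only: dvd_0_left_iff)
    then show False using pos by (simp only: less_irrefl)
  qed
  note iff = dvd_minors_gcd_iff[OF A S this, folded a_def]
  have "?d dvd minors_gcd (columns_submatrix A S)"
    unfolding iff by (intro allI impI diagonal_dvd_minor[OF v]) (erule conjunct2)
  moreover have "minors_gcd (columns_submatrix A S) dvd ?d"
  proof (rule dvd_diagonal[OF v finS])
    fix f :: "nat \<Rightarrow> nat" assume "inj_on f {..<n}" "f ` {..<n} \<subseteq> S"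
    then show "minors_gcd (columns_submatrix A S) dvd minor f"
      using iffD1[OF iff dvd_refl, THEN spec, of f] by simp
  qed
  moreover have "minors_gcd (columns_submatrix A S) \<ge> 0" unfolding minors_gcd_def by simp
  ultimately have "?d = minors_gcd (columns_submatrix A S)" using pos by (intro zdvd_antisym_nonneg) auto
  then show "int (card (torsion_points S)) = minors_gcd (columns_submatrix A S)"
    "minors_gcd (columns_submatrix A S) > 0"
    using card_torsion_points(2)[OF v] pos by auto
qed

section \<open>Spanning sets\<close>

text \<open>
  The columns in \<open>S\<close> span \<open>\<real>\<^sup>n\<close> if and only if the rows are independent on \<open>S\<close>. If a unit vector is a
  combination of columns, then a linear relation between the rows has a zero coefficient there.
  Conversely, elimination over \<open>\<real>\<close> with a triangular basis of the column lattice expresses every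
  vector by the columns.
\<close>

lemma spanning_iff_full_rank_on:
  fixes A :: "int mat"
  assumes A: "A \<in> carrier_mat n m" and rk: "vec_space.rank n (real_mat A) = n"
  shows "matroid_spanning A S \<longleftrightarrow>
    S \<subseteq> {..<m} \<and> integer_matrix.full_rank_on n (\<lambda>i j. A $$ (i, j)) S"
proof (cases "S \<subseteq> {..<m}")
  case False
  then show ?thesis using matroid_spanning_iff_span[OF A rk] by blast
next
  case S: True
  interpret V: vec_space "TYPE(real)" n .
  interpret integer_matrix n "\<lambda>i j. A $$ (i, j)" .
  let ?c = "col (real_mat A)"
  let ?W = "V.span (?c ` S)"
  have c: "?c j \<in> carrier_vec n" "\<And>i. i < n \<Longrightarrow> ?c j $ i = of_int (A $$ (i, j))" if "j \<in> S" for j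
    using that S A by auto
  have cS: "?c ` S \<subseteq> carrier_vec n" using c(1) by blast
  have finS: "finite S" using S finite_subset by blast
  have "?W = carrier_vec n \<longleftrightarrow> full_rank_on S"
  proof
    assume W: "?W = carrier_vec n"
    show "full_rank_on S"
      unfolding full_rank_on_def
    proof (intro allI impI)
      fix y k assume y: "\<forall>j\<in>S. row_comb y j = 0" and k: "k < n"
      have "unit_vec n k \<in> ?W" unfolding W by simp
      then obtain l T where l: "unit_vec n k = V.lincomb l T" and T: "T \<subseteq> ?c ` S"
        using V.in_spanE by blast
      have "y k = (\<Sum>i<n. y i * unit_vec n k $ i)"
      proof -
        have "(\<Sum>i<n. y i * unit_vec n k $ i) = (\<Sum>i<n. if i = k then y i else 0)"
          by (rule sum.cong) (auto simp: unit_vec_def)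
        then show ?thesis using k by simp
      qed
      also have "\<dots> = (\<Sum>i<n. \<Sum>p\<in>T. l p * (y i * p $ i))"
      proof (rule sum.cong)
        fix i assume "i \<in> {..<n}"
        then have "unit_vec n k $ i = (\<Sum>p\<in>T. l p * p $ i)"
          unfolding l using T cS by (intro V.lincomb_index) auto
        then show "y i * unit_vec n k $ i = (\<Sum>p\<in>T. l p * (y i * p $ i))"
          by (simp add: sum_distrib_left mult_ac)
      qed simp
      also have "\<dots> = (\<Sum>p\<in>T. \<Sum>i<n. l p * (y i * p $ i))" by (rule sum.swap)
      also have "\<dots> = 0"
      proof (rule sum.neutral, rule ballI)
        fix p assume "p \<in> T"
        then obtain j where j: "j \<in> S" "p = ?c j" using T by blast
        have "(\<Sum>i<n. y i * p $ i) = row_comb y j"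
          unfolding row_comb_def by (rule sum.cong) (simp_all add: j c)
        then show "(\<Sum>i<n. l p * (y i * p $ i)) = 0"
          using y j(1) by (simp flip: sum_distrib_left)
      qed
      finally show "y k = 0" .
    qed
  next
    assume full: "full_rank_on S"
    obtain v where v: "triangular_basis S v"
      by (rule triangular_basis_exists[OF finS full_rank_on_imp_integer[OF full]])
    have comb: "vec n (\<lambda>i. \<Sum>s\<in>F. g s * of_int (A $$ (i, s))) \<in> ?W"
      if "finite F" "F \<subseteq> S" for F and g :: "nat \<Rightarrow> real"
      using that
    proof (induction F rule: finite_induct)
      case empty
      have "V.lincomb (\<lambda>_. 0) {} \<in> ?W" unfolding V.span_def by blast
      moreover have "vec n (\<lambda>i. \<Sum>s\<in>{}. g s * of_int (A $$ (i, s))) = V.lincomb (\<lambda>_. 0) {}"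
        by (auto simp: V.lincomb_def)
      ultimately show ?case by simp
    next
      case (insert s F)
      have "g s \<cdot>\<^sub>v ?c s \<in> ?W"
        using insert.prems V.in_own_span[of "?c ` S"] cS by (intro V.smult_in_span[OF cS]) auto
      moreover have "vec n (\<lambda>i. \<Sum>s\<in>F. g s * of_int (A $$ (i, s))) \<in> ?W" using insert by auto
      ultimately have "g s \<cdot>\<^sub>v ?c s + vec n (\<lambda>i. \<Sum>s\<in>F. g s * of_int (A $$ (i, s))) \<in> ?W"
        using V.span_add1[of "?c ` S"] cS by simp
      moreover have "g s \<cdot>\<^sub>v ?c s + vec n (\<lambda>i. \<Sum>s\<in>F. g s * of_int (A $$ (i, s)))
          = vec n (\<lambda>i. \<Sum>s\<in>insert s F. g s * of_int (A $$ (i, s)))"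
        using insert.hyps insert.prems S A by (intro eq_vecI) auto
      ultimately show ?case by simp
    qed
    have "carrier_vec n \<subseteq> ?W"
    proof
      fix x :: "real vec" assume x: "x \<in> carrier_vec n"
      show "x \<in> ?W"
      proof (rule triangular_basisE[OF v])
        fix u
        assume pos: "\<And>j. j < n \<Longrightarrow> 0 < v j j"
          and tri: "\<And>i j. j < i \<Longrightarrow> i < n \<Longrightarrow> v j i = 0"
          and u: "\<And>j i. j < n \<Longrightarrow> i < n \<Longrightarrow> v j i = (\<Sum>s\<in>S. u j s * A $$ (i, s))"
        have dvd: "real_of_int (v j j) dvd z j" if "j < n" for j z
          using pos[OF that] by (simp add: dvd_field_iff)
        have "\<exists>c. \<forall>i<n. x $ i = (\<Sum>j<n. c j * real_of_int (v j i))"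
          using tri dvd
          by (intro triangular_reduction[of UNIV n "\<lambda>j i. real_of_int (v j i)" "\<lambda>i. x $ i"]) auto
        then obtain c where c: "\<And>i. i < n \<Longrightarrow> x $ i = (\<Sum>j<n. c j * real_of_int (v j i))"
          by blast
        have "x $ i = (\<Sum>s\<in>S. (\<Sum>j<n. c j * of_int (u j s)) * of_int (A $$ (i, s)))"
          if "i < n" for i
        proof -
          have "x $ i = (\<Sum>j<n. \<Sum>s\<in>S. c j * of_int (u j s) * of_int (A $$ (i, s)))"
            unfolding c[OF that]
            by (rule sum.cong) (simp_all add: u that sum_distrib_left mult.assoc)
          also have "\<dots> = (\<Sum>s\<in>S. \<Sum>j<n. c j * of_int (u j s) * of_int (A $$ (i, s)))"
            by (rule sum.swap)
          finally show ?thesis by (simp only: sum_distrib_right)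
        qed
        then have "x = vec n (\<lambda>i. \<Sum>s\<in>S. (\<Sum>j<n. c j * of_int (u j s)) * of_int (A $$ (i, s)))"
          using x by (intro eq_vecI) auto
        then show ?thesis using comb[OF finS subset_refl] by simp
      qed
    qed
    then show "?W = carrier_vec n" using V.span_is_subset2[of "?c ` S"] cS by auto
  qed
  then show ?thesis using matroid_spanning_iff_span[OF A rk] S by blast
qed

section \<open>The lattice Gale zonotope\<close>

text \<open>
  Multiplication by the transpose of \<open>D\<close>, for a vector given as a function.
\<close>

definition dual_map :: "int mat \<Rightarrow> (nat \<Rightarrow> real) \<Rightarrow> real vec" where
  "dual_map D x = vec (dim_col D) (\<lambda>i. \<Sum>j<dim_row D. of_int (D $$ (j, i)) * x j)"

lemma dual_map_cong: "(\<And>j. j < dim_row D \<Longrightarrow> x j = y j) \<Longrightarrow> dual_map D x = dual_map D y"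
  by (intro eq_vecI) (auto simp: dual_map_def)

lemma dual_map_carrier: "dual_map D x \<in> carrier_vec (dim_col D)"
  by (simp add: dual_map_def)

lemma dual_map_of_int_in_int_points: "dual_map D (\<lambda>j. of_int (x j)) \<in> int_points (dim_col D)"
  unfolding int_points_def
proof (intro CollectI conjI allI impI dual_map_carrier)
  fix i assume "i < dim_col D"
  then have "dual_map D (\<lambda>j. of_int (x j)) $ i = of_int (\<Sum>j<dim_row D. D $$ (j, i) * x j)"
    by (simp add: dual_map_def)
  then show "dual_map D (\<lambda>j. of_int (x j)) $ i \<in> \<int>" by (simp only: Ints_of_int)
qed

lemma dilate_zonotope_transpose:
  assumes "t > 0"
  shows "dilate t (zonotope (transpose_mat D))
    = {dual_map D x | x. \<forall>j<dim_row D. 0 \<le> x j \<and> x j \<le> real t}"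
proof -
  have img: "real t \<cdot>\<^sub>v (real_mat (transpose_mat D) *\<^sub>v x) = dual_map D (\<lambda>j. real t * x $ j)"
    if "x \<in> carrier_vec (dim_row D)" for x
    using that
    by (intro eq_vecI)
      (auto simp: dual_map_def scalar_prod_def sum_distrib_left atLeast0LessThan mult_ac)
  show ?thesis
  proof (intro equalityI subsetI)
    fix p assume "p \<in> dilate t (zonotope (transpose_mat D))"
    then obtain x where x: "x \<in> carrier_vec (dim_row D)" "\<forall>i<dim_row D. 0 \<le> x $ i \<and> x $ i \<le> 1"
      and p: "p = real t \<cdot>\<^sub>v (real_mat (transpose_mat D) *\<^sub>v x)"
      unfolding dilate_def zonotope_def by auto
    have "\<forall>j<dim_row D. 0 \<le> real t * x $ j \<and> real t * x $ j \<le> real t"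
      using x(2) by (auto intro: mult_left_le)
    then show "p \<in> {dual_map D x | x. \<forall>j<dim_row D. 0 \<le> x j \<and> x j \<le> real t}"
      unfolding p img[OF x(1)] by blast
  next
    fix p assume "p \<in> {dual_map D x | x. \<forall>j<dim_row D. 0 \<le> x j \<and> x j \<le> real t}"
    then obtain x where p: "p = dual_map D x" and x: "\<forall>j<dim_row D. 0 \<le> x j \<and> x j \<le> real t"
      by blast
    let ?x = "vec (dim_row D) (\<lambda>j. x j / real t)"
    have "p = real t \<cdot>\<^sub>v (real_mat (transpose_mat D) *\<^sub>v ?x)"
      unfolding p using assms by (subst img) (auto intro: dual_map_cong)
    moreover have "real_mat (transpose_mat D) *\<^sub>v ?x \<in> zonotope (transpose_mat D)"
      unfolding zonotope_def using x assms by (intro CollectI exI[of _ ?x] conjI) auto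
    ultimately show "p \<in> dilate t (zonotope (transpose_mat D))" unfolding dilate_def by blast
  qed
qed

locale gale_dual_pair =
  fixes n m :: nat and A D :: "int mat"
  assumes A: "A \<in> carrier_mat n m" and dual: "lattice_gale_dual n m A D"
    and full: "integer_matrix.full_rank_on n (\<lambda>i j. A $$ (i, j)) {..<m}"
begin

sublocale integer_matrix n "\<lambda>i j. A $$ (i, j)" .

sublocale dual: integer_matrix "m - n" "\<lambda>i j. D $$ (j, i)" .

lemma dims: "dim_row A = n" "dim_col A = m"
    "dim_row D = m" "dim_col D = m - n"
  using A dual unfolding lattice_gale_dual_def by auto

text \<open>
  The defining property of the lattice Gale dual, in coordinates.
\<close>

lemma kernel_iff:
  fixes z :: "nat \<Rightarrow> int"
  shows "(\<forall>i<n. (\<Sum>j<m. z j * A $$ (i, j)) = 0)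
    \<longleftrightarrow> (\<exists>c::nat \<Rightarrow> int. \<forall>j<m. z j = (\<Sum>k<m - n. c k * D $$ (j, k)))"
proof -
  have ker: "{D *\<^sub>v c | c. c \<in> carrier_vec (m - n)} = mat_kernel A"
    using dual dims unfolding lattice_gale_dual_def lattice_basis_cols_def by simp
  have "(\<forall>i<n. (\<Sum>j<m. z j * A $$ (i, j)) = 0) \<longleftrightarrow> A *\<^sub>v vec m z = 0\<^sub>v n"
    unfolding vec_eq_iff using dims
    by (auto simp: scalar_prod_def atLeast0LessThan mult.commute)
  also have "\<dots> \<longleftrightarrow> vec m z \<in> mat_kernel A" unfolding mat_kernel[OF A] by simp
  also have "\<dots> \<longleftrightarrow> (\<exists>c \<in> carrier_vec (m - n). vec m z = D *\<^sub>v c)" unfolding ker[symmetric] by auto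
  also have "\<dots> \<longleftrightarrow> (\<exists>c::nat \<Rightarrow> int. vec m z = D *\<^sub>v vec (m - n) c)"
  proof
    assume "\<exists>c \<in> carrier_vec (m - n). vec m z = D *\<^sub>v c"
    then obtain c where c: "c \<in> carrier_vec (m - n)" "vec m z = D *\<^sub>v c" by blast
    have "vec (m - n) (\<lambda>k. c $ k) = c" using c(1) by auto
    then show "\<exists>c. vec m z = D *\<^sub>v vec (m - n) c"
      using c(2) by (intro exI[of _ "\<lambda>k. c $ k"]) simp
  next
    assume "\<exists>c. vec m z = D *\<^sub>v vec (m - n) c"
    then obtain c where "vec m z = D *\<^sub>v vec (m - n) c" by (rule exE)
    then show "\<exists>c \<in> carrier_vec (m - n). vec m z = D *\<^sub>v c"
      by (intro bexI[of _ "vec (m - n) c"]) auto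
  qed
  also have "\<dots> \<longleftrightarrow> (\<exists>c::nat \<Rightarrow> int. \<forall>j<m. z j = (\<Sum>k<m - n. c k * D $$ (j, k)))"
    unfolding vec_eq_iff using dims
    by (intro ex_cong1) (simp add: scalar_prod_def atLeast0LessThan mult.commute)
  finally show ?thesis .
qed

lemma product_zero:
  assumes "i < n" "k < m - n"
  shows "(\<Sum>j<m. D $$ (j, k) * A $$ (i, j)) = 0"
proof -
  have "D $$ (j, k) = (\<Sum>l<m - n. (if l = k then 1 else 0) * D $$ (j, l))" for j
  proof -
    have "(\<Sum>l<m - n. (if l = k then 1 else 0) * D $$ (j, l))
        = (\<Sum>l<m - n. if l = k then D $$ (j, l) else 0)"
      by (rule sum.cong) auto
    then show ?thesis using assms(2) by simp
  qed
  then have "\<exists>c::nat \<Rightarrow> int. \<forall>j<m. D $$ (j, k) = (\<Sum>l<m - n. c l * D $$ (j, l))"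
    by (intro exI[of _ "\<lambda>l. if l = k then 1 else 0"]) simp
  then show ?thesis using kernel_iff[of "\<lambda>j. D $$ (j, k)"] assms(1) by simp
qed

lemma dual_integer_full_rank: "dual.integer_full_rank_on {..<m}"
  unfolding dual.integer_full_rank_on_def
proof (intro allI impI)
  fix z :: "nat \<Rightarrow> int" and i
  assume z: "\<forall>j\<in>{..<m}. (\<Sum>k<m - n. z k * D $$ (j, k)) = 0" and i: "i < m - n"
  have "D *\<^sub>v vec (m - n) z = 0\<^sub>v m"
    using z dims by (intro eq_vecI) (auto simp: scalar_prod_def atLeast0LessThan mult.commute)
  then have "vec (m - n) z = 0\<^sub>v (m - n)"
    using dual dims unfolding lattice_gale_dual_def lattice_basis_cols_def by simp
  then show "z i = 0" using i by (metis index_vec index_zero_vec(1))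
qed

lemma dual_triangular_basis:
  obtains v where "dual.triangular_basis {..<m} v"
  by (rule dual.triangular_basis_exists[OF finite_lessThan dual_integer_full_rank])

text \<open>
  The columns of \<open>D\<close> span a saturated lattice: an integral real combination \<open>D y\<close> lies in the integer
  kernel of \<open>A\<close>, hence is \<open>D c\<close> with \<open>c\<close> integral, and \<open>y = c\<close> by independence.
\<close>

lemma dual_torsion_points: "dual.torsion_points {..<m} = {\<lambda>k\<in>{..<m - n}. 0}"
proof (intro equalityI subsetI)
  fix y assume y: "y \<in> dual.torsion_points {..<m}"
  then have yE: "y \<in> {..<m - n} \<rightarrow>\<^sub>E {0..<1}" unfolding dual.torsion_points_def by simp
  define x where "x j = \<lfloor>dual.row_comb y j\<rfloor>" for j
  have x: "of_int (x j) = dual.row_comb y j" if "j < m" for j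
    using y that unfolding dual.torsion_points_def x_def by (auto elim!: Ints_cases)
  have "(\<Sum>j<m. x j * A $$ (i, j)) = 0" if i: "i < n" for i
  proof -
    have "real_of_int (\<Sum>j<m. x j * A $$ (i, j))
        = (\<Sum>j<m. \<Sum>k<m - n. y k * of_int (D $$ (j, k) * A $$ (i, j)))"
      unfolding of_int_sum of_int_mult
      by (rule sum.cong) (simp_all add: x dual.row_comb_def sum_distrib_right mult.assoc)
    also have "\<dots> = (\<Sum>k<m - n. \<Sum>j<m. y k * of_int (D $$ (j, k) * A $$ (i, j)))"
      by (rule sum.swap)
    also have "\<dots> = (\<Sum>k<m - n. y k * of_int (\<Sum>j<m. D $$ (j, k) * A $$ (i, j)))"
      by (simp only: sum_distrib_left of_int_sum)
    also have "\<dots> = 0" using product_zero[OF i] by simp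
    finally show ?thesis by (simp only: of_int_eq_0_iff)
  qed
  then obtain c :: "nat \<Rightarrow> int" where c: "\<And>j. j < m \<Longrightarrow> x j = (\<Sum>k<m - n. c k * D $$ (j, k))"
    using kernel_iff[of x] by auto
  obtain v where v: "dual.triangular_basis {..<m} v" by (rule dual_triangular_basis)
  have yc: "y k = of_int (c k)" if "k < m - n" for k
  proof (rule dual.full_rank_onD[OF dual.triangular_basis_imp_full_rank[OF v] _ that])
    fix j assume "j \<in> {..<m}"
    then show "dual.row_comb y j = dual.row_comb (\<lambda>k. of_int (c k)) j"
      unfolding dual.row_comb_of_int using x[of j] c[of j] by simp
  qed
  have "y k = 0" if "k < m - n" for k
  proof -
    have "y k \<in> {0..<1}" using yE that by (auto simp: PiE_iff)
    then have "of_int (-1) < real_of_int (c k)" "real_of_int (c k) < of_int 1"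
      using yc[OF that] by auto
    then have "c k = 0" unfolding of_int_less_iff by simp
    then show ?thesis using yc[OF that] by simp
  qed
  then have "y = (\<lambda>k\<in>{..<m - n}. 0)"
    using yE by (auto simp: fun_eq_iff PiE_iff extensional_def)
  then show "y \<in> {\<lambda>k\<in>{..<m - n}. 0}" by simp
next
  fix y assume "y \<in> {\<lambda>k\<in>{..<m - n}. 0 :: real}"
  moreover have "dual.row_comb (\<lambda>k\<in>{..<m - n}. 0) j = 0" for j
    by (simp add: dual.row_comb_def)
  ultimately show "y \<in> dual.torsion_points {..<m}" by (simp add: dual.torsion_points_def)
qed

text \<open>
  A saturated column lattice has index \<open>1\<close>, so the rows of \<open>D\<close>, which are the columns of its transpose,
  generate \<open>\<int>\<^bsup>m - n\<^esup>\<close>.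
\<close>

lemma lattice_point_lift:
  assumes "p \<in> int_points (m - n)"
  shows "\<exists>x::nat \<Rightarrow> int. dual_map D (\<lambda>j. of_int (x j)) = p"
proof -
  obtain v where v: "dual.triangular_basis {..<m} v" by (rule dual_triangular_basis)
  have "card (dual.torsion_points {..<m}) = 1" unfolding dual_torsion_points by simp
  then obtain x where x: "\<And>k. k < m - n \<Longrightarrow> \<lfloor>p $ k\<rfloor> = (\<Sum>j<m. x j * D $$ (j, k))"
    using dual.columns_generate_if_saturated[OF v, of "\<lambda>k. \<lfloor>p $ k\<rfloor>"] by auto
  have "dual_map D (\<lambda>j. of_int (x j)) $ k = p $ k" if "k < m - n" for k
  proof -
    have "p $ k = of_int \<lfloor>p $ k\<rfloor>"
      using assms that unfolding int_points_def by (auto elim!: Ints_cases)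
    then show ?thesis using that x[OF that] dims by (simp add: dual_map_def mult.commute)
  qed
  moreover have "dim_vec p = m - n" using assms unfolding int_points_def by auto
  ultimately have "dual_map D (\<lambda>j. of_int (x j)) = p"
    using dims by (intro eq_vecI) (auto simp: dual_map_def)
  then show ?thesis by (rule exI[of _ x])
qed

text \<open>
  The kernel of \<open>D\<^sup>T\<close> is the row space of \<open>A\<close>.
\<close>

lemma dual_map_eq_iff:
  "dual_map D x = dual_map D x' \<longleftrightarrow> (\<exists>y. \<forall>j\<in>{..<m}. x j - x' j = row_comb y j)"
proof
  assume eq: "dual_map D x = dual_map D x'"
  obtain v where v: "triangular_basis {..<m} v"
    by (rule triangular_basis_exists[OF finite_lessThan full_rank_on_imp_integer[OF full]])
  show "\<exists>y. \<forall>j\<in>{..<m}. x j - x' j = row_comb y j"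
  proof (rule orthogonal_to_integer_kernel_imp_row_comb[OF v finite_lessThan])
    fix z :: "nat \<Rightarrow> int" assume "\<And>i. i < n \<Longrightarrow> (\<Sum>j<m. z j * A $$ (i, j)) = 0"
    then obtain c :: "nat \<Rightarrow> int" where c: "\<And>j. j < m \<Longrightarrow> z j = (\<Sum>k<m - n. c k * D $$ (j, k))"
      using kernel_iff[of z] by auto
    have k0: "(\<Sum>j<m. of_int (D $$ (j, k)) * (x j - x' j)) = 0" if "k < m - n" for k
    proof -
      have "dual_map D x $ k = dual_map D x' $ k" using eq by simp
      then show ?thesis
        using that dims by (simp add: dual_map_def right_diff_distrib sum_subtractf)
    qed
    have "(\<Sum>j<m. of_int (z j) * (x j - x' j))
        = (\<Sum>j<m. \<Sum>k<m - n. of_int (c k) * (of_int (D $$ (j, k)) * (x j - x' j)))"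
      by (rule sum.cong) (simp_all add: c sum_distrib_right mult.assoc)
    also have "\<dots> = (\<Sum>k<m - n. \<Sum>j<m. of_int (c k) * (of_int (D $$ (j, k)) * (x j - x' j)))"
      by (rule sum.swap)
    also have "\<dots> = (\<Sum>k<m - n. of_int (c k) * (\<Sum>j<m. of_int (D $$ (j, k)) * (x j - x' j)))"
      by (simp only: sum_distrib_left)
    also have "\<dots> = 0" using k0 by simp
    finally show "(\<Sum>j<m. of_int (z j) * (x j - x' j)) = 0" .
  qed
next
  assume "\<exists>y. \<forall>j\<in>{..<m}. x j - x' j = row_comb y j"
  then obtain y where y: "\<And>j. j < m \<Longrightarrow> x j - x' j = row_comb y j" by auto
  show "dual_map D x = dual_map D x'"
  proof (rule eq_vecI)
    fix k assume "k < dim_vec (dual_map D x')"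
    then have k: "k < m - n" using dims by (simp add: dual_map_def)
    have "dual_map D x $ k - dual_map D x' $ k = (\<Sum>j<m. of_int (D $$ (j, k)) * (x j - x' j))"
      using k dims by (simp add: dual_map_def right_diff_distrib sum_subtractf)
    also have "\<dots> = (\<Sum>j<m. \<Sum>i<n. y i * of_int (D $$ (j, k) * A $$ (i, j)))"
      by (rule sum.cong) (simp_all add: y row_comb_def sum_distrib_left mult_ac)
    also have "\<dots> = (\<Sum>i<n. \<Sum>j<m. y i * of_int (D $$ (j, k) * A $$ (i, j)))"
      by (rule sum.swap)
    also have "\<dots> = (\<Sum>i<n. y i * of_int (\<Sum>j<m. D $$ (j, k) * A $$ (i, j)))"
      by (simp only: sum_distrib_left of_int_sum)
    also have "\<dots> = 0" using product_zero[OF _ k] by simp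
    finally show "dual_map D x $ k = dual_map D x' $ k" by simp
  qed (simp add: dual_map_def)
qed

text \<open>
  The map \<open>D\<^sup>T\<close> sends the classes modulo the row lattice onto the lattice points of the dilated zonotope. Each
  of its fibres is a translate of the saturation of the row lattice, modulo the row lattice.
\<close>

lemma card_box_classes_eq_lattice_points:
  assumes t: "t > 0"
  defines "P \<equiv> dilate t (zonotope (transpose_mat D)) \<inter> int_points (m - n)"
  shows "finite P"
    and "card (box_classes t {..<m} {..<m}) = card P * card (torsion_points {..<m})"
proof -
  let ?M = "{..<m}"
  let ?dual = "\<lambda>x::nat \<Rightarrow> int. dual_map D (\<lambda>j. of_int (x j))"
  let ?fib = "\<lambda>p. {row_cong ?M `` {x} | x. ?dual x = p}"
  have box: "(\<exists>y. in_box t ?M ?M x y) \<longleftrightarrow> ?dual x \<in> P" for x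
  proof
    assume "\<exists>y. in_box t ?M ?M x y"
    then obtain y where y: "in_box t ?M ?M x y" by (rule exE)
    have "?dual x = dual_map D (\<lambda>j. of_int (x j) - row_comb y j)"
      unfolding dual_map_eq_iff by (rule exI[of _ y]) simp
    moreover have "\<forall>j<dim_row D. 0 \<le> of_int (x j) - row_comb y j \<and> of_int (x j) - row_comb y j \<le> real t"
      using y dims unfolding in_box_def by simp
    ultimately have "?dual x \<in> dilate t (zonotope (transpose_mat D))"
      unfolding dilate_zonotope_transpose[OF t] by (intro CollectI exI[of _ "\<lambda>j. of_int (x j) - row_comb y j"] conjI)
    then show "?dual x \<in> P"
      unfolding P_def using dual_map_of_int_in_int_points[of D x] dims by simp
  next
    assume "?dual x \<in> P"
    then obtain x' where eq: "?dual x = dual_map D x'"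
      and x': "\<forall>j<dim_row D. 0 \<le> x' j \<and> x' j \<le> real t"
      unfolding P_def dilate_zonotope_transpose[OF t] by auto
    obtain y where y: "\<forall>j\<in>?M. of_int (x j) - x' j = row_comb y j"
      using eq unfolding dual_map_eq_iff by (rule exE)
    have "of_int (x j) - row_comb y j = x' j" if "j \<in> ?M" for j
      using bspec[OF y that] by simp
    then have "in_box t ?M ?M x y" unfolding in_box_def using x' dims by simp
    then show "\<exists>y. in_box t ?M ?M x y" by (rule exI[of _ y])
  qed
  have same: "?dual x = ?dual x'" if "row_cong ?M `` {x} = row_cong ?M `` {x'}" for x x'
  proof -
    have "(x, x') \<in> row_cong ?M" using that by (simp only: row_cong_class_eq_iff)
    then obtain z :: "nat \<Rightarrow> int"
      where "\<forall>j\<in>?M. real_of_int (x j - x' j) = row_comb (\<lambda>i. of_int (z i)) j"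
      unfolding row_cong_iff by (rule exE)
    then show ?thesis
      unfolding dual_map_eq_iff by (intro exI[of _ "\<lambda>i. of_int (z i)"]) simp
  qed
  have card_fib: "card (?fib p) = card (torsion_points ?M)" and fib_ne: "?fib p \<noteq> {}"
    if "p \<in> P" for p
  proof -
    have "p \<in> int_points (m - n)" using that unfolding P_def by simp
    from lattice_point_lift[OF this] obtain x0 where x0: "?dual x0 = p" by (rule exE)
    have "?dual x = p \<longleftrightarrow> (\<exists>y. \<forall>j\<in>?M. real_of_int (x j - x0 j) = row_comb y j)" for x
      unfolding x0[symmetric] dual_map_eq_iff by simp
    then show "card (?fib p) = card (torsion_points ?M)"
      using card_classes_of_saturated_coset[OF full, of x0] by simp
    show "?fib p \<noteq> {}" using x0 by blast
  qed
  have union: "box_classes t ?M ?M = (\<Union>p\<in>P. ?fib p)"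
    unfolding box_classes_def box quotient_def by blast
  have fin: "finite (\<Union>p\<in>P. ?fib p)"
    unfolding union[symmetric] by (rule finite_box_classes) simp
  have disj: "?fib p \<inter> ?fib q = {}" if "p \<noteq> q" for p q
  proof (rule ccontr)
    assume "?fib p \<inter> ?fib q \<noteq> {}"
    then obtain x x' where "row_cong ?M `` {x} = row_cong ?M `` {x'}" "?dual x = p" "?dual x' = q"
      by auto
    then show False using same[of x x'] that by simp
  qed
  have inj: "inj_on ?fib P"
  proof (rule inj_onI)
    fix p q assume "p \<in> P" and eq: "?fib p = ?fib q"
    show "p = q"
    proof (rule ccontr)
      assume "p \<noteq> q"
      then show False using disj[of p q] fib_ne[OF \<open>p \<in> P\<close>] eq by simp
    qed
  qed
  have "finite (\<Union> (?fib ` P))" using fin by simp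
  then have "finite (?fib ` P)" by (rule finite_UnionD)
  then show finP: "finite P" using inj by (rule finite_imageD)
  have "card (\<Union>p\<in>P. ?fib p) = (\<Sum>p\<in>P. card (?fib p))"
  proof (rule card_UN_disjoint[OF finP])
    show "\<forall>p\<in>P. finite (?fib p)"
    proof
      fix p assume "p \<in> P"
      then have "?fib p \<subseteq> (\<Union>p\<in>P. ?fib p)" by (rule UN_upper)
      then show "finite (?fib p)" using fin by (rule finite_subset)
    qed
    show "\<forall>p\<in>P. \<forall>q\<in>P. p \<noteq> q \<longrightarrow> ?fib p \<inter> ?fib q = {}"
      by (intro ballI impI disj)
  qed
  also have "\<dots> = card P * card (torsion_points ?M)" using card_fib by simp
  finally show "card (box_classes t ?M ?M) = card P * card (torsion_points ?M)"
    unfolding union .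
qed

end

text \<open>
  Counting the classes of the full box in two ways, by lattice points and by the unfolded
  recurrence, gives \<open>g(A)\<close> times the claimed identity.
\<close>

theorem theorem5p1:
  fixes A D :: "int mat" and n m :: nat
  assumes "A \<in> carrier_mat n m"
    and "vec_space.rank n (real_mat A) = n"
    and "lattice_gale_dual n m A D"
  shows "is_ehrhart_polynomial (m - n) (zonotope (transpose_mat D))
           (\<Sum>S | matroid_spanning A S.
              monom (real_of_int (minors_gcd (columns_submatrix A S)) / real_of_int (minors_gcd A))
                (m - card S))"
proof -
  let ?a = "\<lambda>i j. A $$ (i, j)" and ?M = "{..<m}"
  let ?g = "\<lambda>S. minors_gcd (columns_submatrix A S)"
  note span = spanning_iff_full_rank_on[OF assms(1,2)]
  \<comment> \<open>a maximal independent set is a basis, so the whole ground set is spanning\<close>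
  have "matroid_spanning A ?M"
  proof -
    let ?F = "{I. matroid_indep A I}"
    have "?F \<subseteq> Pow {..<dim_col A}" by (auto simp: matroid_indep_def)
    then have "finite ?F" by (rule finite_subset) simp
    moreover have "{} \<in> ?F"
    proof -
      interpret V: vec_space "TYPE(real)" "dim_row A" .
      show ?thesis by (simp add: matroid_indep_def V.lin_dep_def)
    qed
    ultimately obtain B where B: "B \<in> ?F" "\<forall>I\<in>?F. B \<subseteq> I \<longrightarrow> B = I"
      using finite_has_maximal[of ?F] by (metis (no_types, lifting) empty_iff)
    then have "matroid_basis A B" unfolding matroid_basis_def by auto
    moreover have "B \<subseteq> ?M" using B(1) assms(1) by (auto simp: matroid_indep_def)
    ultimately show ?thesis unfolding matroid_spanning_def using assms(1) by auto
  qed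
  then have full: "integer_matrix.full_rank_on n ?a ?M" using span by simp
  interpret gale_dual_pair n m A D
    by unfold_locales (use assms full in auto)
  have gM: "?g ?M = minors_gcd A" by (simp only: columns_submatrix_all[OF assms(1)])
  have tors: "real (card (torsion_points S)) = real_of_int (?g S)"
    if "S \<subseteq> ?M" "full_rank_on S" for S
    using card_torsion_points_eq_minors_gcd(1)[OF assms(1) that] by (metis of_int_of_nat_eq)
  have gA: "real_of_int (minors_gcd A) > 0"
    using card_torsion_points_eq_minors_gcd(2)[OF assms(1) subset_refl full] unfolding gM by simp
  show ?thesis
    unfolding is_ehrhart_polynomial_def
  proof (intro allI impI conjI)
    fix t :: nat assume t: "t > 0"
    let ?P = "dilate t (zonotope (transpose_mat D)) \<inter> int_points (m - n)"
    show "finite ?P" by (rule card_box_classes_eq_lattice_points(1)[OF t])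
    have "real_of_int (minors_gcd A) * real (card ?P) = real (card (box_classes t ?M ?M))"
      using card_box_classes_eq_lattice_points(2)[OF t] tors[OF subset_refl full] gM
      by (simp add: mult.commute)
    also have "\<dots> = (\<Sum>C | C \<subseteq> ?M \<and> full_rank_on (?M - C).
        real t ^ card C * real (card (torsion_points (?M - C))))"
      unfolding card_box_classes_eq_sum[OF finite_lessThan subset_refl full] by simp
    also have "\<dots> = (\<Sum>S | matroid_spanning A S. real t ^ (m - card S) * real_of_int (?g S))"
    proof (rule sum.reindex_bij_witness[of _ "\<lambda>S. ?M - S" "\<lambda>C. ?M - C"])
      fix C assume C: "C \<in> {C. C \<subseteq> ?M \<and> full_rank_on (?M - C)}"
      then show "?M - (?M - C) = C" "?M - C \<in> {S. matroid_spanning A S}"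
        unfolding span by auto
      have "finite C" using C finite_subset by blast
      then have "card (?M - C) = m - card C" using C by (simp add: card_Diff_subset)
      moreover have "card C \<le> m" using C card_mono[of ?M C] by simp
      ultimately show "real t ^ (m - card (?M - C)) * real_of_int (?g (?M - C))
          = real t ^ card C * real (card (torsion_points (?M - C)))"
        using tors[of "?M - C"] C by simp
    next
      fix S assume "S \<in> {S. matroid_spanning A S}"
      then have S: "S \<subseteq> ?M" "full_rank_on S" unfolding span by auto
      show "?M - (?M - S) = S" using S(1) by auto
      then show "?M - S \<in> {C. C \<subseteq> ?M \<and> full_rank_on (?M - C)}" using S(2) by simp
    qed
    finally have "real (card ?P)
        = (\<Sum>S | matroid_spanning A S. real t ^ (m - card S) * real_of_int (?g S)) / real_of_int (minors_gcd A)"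
      using gA by (simp add: field_simps)
    then show "poly (\<Sum>S | matroid_spanning A S.
          monom (real_of_int (?g S) / real_of_int (minors_gcd A)) (m - card S)) (real t)
        = real (card ?P)"
      by (simp add: poly_sum poly_monom sum_divide_distrib mult.commute)
  qed
qed

end
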